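(* Let $n\ge 3$, $B_2\subset\mathbb R^n$, and let $T\in C^1(\mathbb R_+\times\mathbb R^n\times\mathcal S^{n\times n})$ satisfy the ellipticity condition that the matrix $\left(-\frac{\partial T}{\partial u_{ij}}\right)$ is positive definite on $\mathbb R_+\times\mathbb R^n\times\mathcal S^{n\times n}$, and the invariance condition that for any positive function $w\in C^2(\mathbb R^n)$ and any $\lambda>0$, $$T(w^\lambda,\nabla w^\lambda,\nabla^2w^\lambda)(\cdot)\equiv T(w,\nabla w,\nabla^2w)(\lambda\,\cdot)\qquad\text{in }\mathbb R^n,\qquad\text{where } w^\lambda(y):=\lambda^{\frac{n-2}{2}}w(\lambda y).$$ Assume that $u\in C^2(B_2\setminus\{0\})$ and $v\in C^2(B_2)$ satisfy $$v>0\ \text{ in } B_2,\qquad u>v\ \text{ in } B_2\setminus\{0\},\qquad \Delta u\le 0\ \text{ in } B_2\setminus\{0\},$$ $$T(u,\nabla u,\nabla^2u)\ge 0\ge T(v,\nabla v,\nabla^2v)\qquad\text{in } B_2\setminus\{0\}.$$ Then $$\liminf_{|x|\to 0}[u(x)-v(x)]>0 .$$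
   Context: $\mathbb R_+=(0,\infty)$; $\mathcal S^{n\times n}$ is the set of real symmetric $n\times n$ matrices; $B_a\subset\mathbb R^n$ is the ball of radius $a$ centered at the origin. $T=T(u,\nabla u,\nabla^2 u)$ and $\frac{\partial T}{\partial u_{ij}}$ denotes the derivative of $T$ with respect to the $(i,j)$ entry of its matrix argument. *)

theory Defs
  imports "HOL-Analysis.Analysis"
begin

text \<open>\<open>grad\<close> and \<open>hess\<close> are meaningful only where the Frechet derivatives involved exist.\<close>

definition grad :: "(real^'n \<Rightarrow> real) \<Rightarrow> real^'n \<Rightarrow> real^'n" where
  "grad f x = (\<chi> i. frechet_derivative f (at x) (axis i 1))"

definition hess :: "(real^'n \<Rightarrow> real) \<Rightarrow> real^'n \<Rightarrow> real^'n^'n" where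
  "hess f x = matrix (frechet_derivative (grad f) (at x))"

definition laplacian :: "(real^'n \<Rightarrow> real) \<Rightarrow> real^'n \<Rightarrow> real" where
  "laplacian f x = trace (hess f x)"

text \<open>The class \<open>C\<^sup>2(S)\<close> for open \<open>S\<close>. Values of \<open>f\<close> outside \<open>S\<close> are irrelevant.\<close>

definition C2_on :: "(real^'n) set \<Rightarrow> (real^'n \<Rightarrow> real) \<Rightarrow> bool" where
  "C2_on S f \<longleftrightarrow>
     (\<forall>x\<in>S. f differentiable (at x)) \<and>
     (\<forall>x\<in>S. grad f differentiable (at x)) \<and>
     continuous_on S (hess f)"

definition sym_mats :: "(real^'n^'n) set" where
  "sym_mats = {A. transpose A = A}"

definition jet_domain :: "(real \<times> (real^'n) \<times> (real^'n^'n)) set" where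
  "jet_domain = {0<..} \<times> UNIV \<times> sym_mats"

text \<open>
  The class \<open>C\<^sup>1\<close> on a relatively open subset \<open>S\<close> of a linear subspace \<open>V\<close>, here used
  for \<open>S = jet_domain\<close>. The derivative within \<open>S\<close> is determined only on \<open>V\<close>; since a continuous
  family of functionals on \<open>V\<close> extends continuously to the whole space (compose with a
  projection), asking for a continuous family of functionals on the whole space is the same as
  asking for continuity of the derivative on \<open>V\<close>.
\<close>

definition C1_on :: "'a::euclidean_space set \<Rightarrow> ('a \<Rightarrow> real) \<Rightarrow> bool" where
  "C1_on S F \<longleftrightarrow>
     (\<exists>F' :: 'a \<Rightarrow> 'a \<Rightarrow>\<^sub>L real.
        (\<forall>p\<in>S. (F has_derivative blinfun_apply (F' p)) (at p within S)) \<and> continuous_on S F')"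

text \<open>
  Derivative with respect to the \<open>(i,j)\<close> entry of a symmetric matrix argument, with the usual
  convention for fully nonlinear equations: \<open>(\<partial>T/\<partial>u\<^sub>i\<^sub>j)\<close> is the symmetric matrix
  such that the differential of \<open>T\<close> in a symmetric direction \<open>H\<close> of the matrix argument is
  \<open>\<Sum>i j. (\<partial>T/\<partial>u\<^sub>i\<^sub>j) H\<^sub>i\<^sub>j\<close>. Its \<open>(i,j)\<close> entry is thus the derivative in the
  direction \<open>(E\<^sub>i\<^sub>j + E\<^sub>j\<^sub>i)/2\<close>, along which the argument stays symmetric.
\<close>

definition sym_unit :: "'n \<Rightarrow> 'n \<Rightarrow> real^'n^'n" where
  "sym_unit i j = (1/2) *\<^sub>R (axis i (axis j 1) + axis j (axis i 1))"

definition dT_mat ::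
    "(real \<times> (real^'n) \<times> (real^'n^'n) \<Rightarrow> real) \<Rightarrow> real \<times> (real^'n) \<times> (real^'n^'n) \<Rightarrow> real^'n^'n" where
  "dT_mat T = (\<lambda>(s, p, M). \<chi> i j. deriv (\<lambda>t. T (s, p, M + t *\<^sub>R sym_unit i j)) 0)"

definition pos_def :: "real^'n^'n \<Rightarrow> bool" where
  "pos_def A \<longleftrightarrow> transpose A = A \<and> (\<forall>x. x \<noteq> 0 \<longrightarrow> x \<bullet> (A *v x) > 0)"

definition elliptic :: "(real \<times> (real^'n) \<times> (real^'n^'n) \<Rightarrow> real) \<Rightarrow> bool" where
  "elliptic T \<longleftrightarrow> (\<forall>q\<in>jet_domain. pos_def (- dT_mat T q))"

definition jet :: "(real^'n \<Rightarrow> real) \<Rightarrow> real^'n \<Rightarrow> real \<times> (real^'n) \<times> (real^'n^'n)" where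
  "jet f x = (f x, grad f x, hess f x)"

definition rescale :: "real \<Rightarrow> (real^'n \<Rightarrow> real) \<Rightarrow> real^'n \<Rightarrow> real" where
  "rescale \<mu> w y = \<mu> powr ((real CARD('n) - 2) / 2) * w (\<mu> *\<^sub>R y)"

definition scaling_invariant :: "(real \<times> (real^'n) \<times> (real^'n^'n) \<Rightarrow> real) \<Rightarrow> bool" where
  "scaling_invariant T \<longleftrightarrow>
     (\<forall>w \<mu>. C2_on UNIV w \<and> (\<forall>y. w y > 0) \<and> \<mu> > 0 \<longrightarrow>
        (\<forall>x. T (jet (rescale \<mu> w) x) = T (jet w (\<mu> *\<^sub>R x))))"

end

theory Submission
  imports Defs
begin

text \<open>
  Write \<open>a = (n - 2) / 2\<close> and \<open>m = v 0\<close>. Invariance under scaling, and under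
  translation because \<open>T\<close> does not depend on \<open>x\<close>, turns \<open>v\<close> into a family of functions
  \<open>l\<^sup>a v(l x + h)\<close> on which the operator is nonpositive. For each small \<open>h\<close>, increase \<open>l\<close> from \<open>1/2\<close>, where the
  function lies below \<open>u\<close>, up to the value \<open>L h\<close> at which it equals \<open>m\<close> at the origin. By the strong
  maximum principle the function cannot meet \<open>u\<close> on the way, so all members with \<open>l = L h\<close> lie
  below \<open>u\<close> in one punctured ball (\<open>matched_translates_below\<close>). All of them take the value \<open>m\<close> at the origin.

  If two of them have different gradients there, \<open>u\<close> lies above a corner with vertex value \<open>m\<close>. A
  superharmonic function stays above a corner by a definite amount near the vertex
  (\<open>corner_lower_bound\<close>), and the lower limit is positive.

  If all gradients agree, then \<open>grad v\<close> is a power of \<open>v\<close> times a constant vector near the origin, which makes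
  \<open>v\<close> subharmonic (\<open>laplacian_nonneg_if_grad_powr\<close>). Then \<open>u - v\<close> is superharmonic and positive in a punctured
  ball, hence bounded away from \<open>0\<close> near the puncture (\<open>gap_if_subharmonic\<close>).

  Two analytic tools carry the argument. The strong maximum principle for the fully nonlinear operator
  is proved with the barrier of Hopf, evaluating the operator at a minimum point rather
  than linearising it. The minimum principle for superharmonic functions across a puncture uses the
  singular barrier \<open>\<bar>x\<bar> powr (- 1/2)\<close>, which is superharmonic because \<open>n \<ge> 3\<close>.
\<close>

section \<open>Pointwise second order jets\<close>

text \<open>A gradient field near the point which is differentiable at the point: this is what the
  chain rule, the second derivative test and the symmetry of the Hessian need, and unlike
  \<open>grad\<close> and \<open>hess\<close> it can be established by exhibiting a field.\<close>

definition has_2jet :: "(real^'n \<Rightarrow> real) \<Rightarrow> real^'n \<Rightarrow> real^'n \<Rightarrow> real^'n^'n \<Rightarrow> bool" where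
  "has_2jet f x p M \<longleftrightarrow> (\<exists>g S. open S \<and> x \<in> S \<and>
     (\<forall>y\<in>S. (f has_derivative (\<lambda>h. g y \<bullet> h)) (at y)) \<and> g x = p \<and> (g has_derivative (*v) M) (at x))"

definition outer :: "real^'n \<Rightarrow> real^'n^'n" where
  "outer p = (\<chi> i j. p$i * p$j)"

lemma outer_mult_vec: "outer p *v x = (p \<bullet> x) *\<^sub>R p"
  by (simp add: outer_def vec_eq_iff matrix_vector_mult_def inner_vec_def sum_distrib_left
      sum_distrib_right mult_ac)

lemma grad_eqI: "(f has_derivative (\<lambda>h. p \<bullet> h)) (at x) \<Longrightarrow> grad f x = p"
  by (simp add: grad_def vec_eq_iff inner_axis frechet_derivative_at[symmetric])

lemma has_derivative_grad:
  assumes "f differentiable (at x)"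
  shows "(f has_derivative (\<lambda>h. grad f x \<bullet> h)) (at x)"
proof -
  let ?D = "frechet_derivative f (at x)"
  have D: "(f has_derivative ?D) (at x)"
    using assms frechet_derivative_works by blast
  then interpret bounded_linear ?D by (rule has_derivative_bounded_linear)
  have "?D h = grad f x \<bullet> h" for h
  proof -
    have "?D h = ?D (\<Sum>i\<in>UNIV. h$i *\<^sub>R axis i 1)"
      using basis_expansion[of h] by (simp add: scalar_mult_eq_scaleR)
    also have "\<dots> = grad f x \<bullet> h"
      by (simp add: sum scaleR grad_def inner_vec_def mult.commute)
    finally show ?thesis .
  qed
  then show ?thesis using D by presburger
qed

lemma has_2jetD:
  assumes "has_2jet f x p M"
  shows "grad f x = p" "hess f x = M"
proof -
  obtain g S where S: "open S" "x \<in> S" and f: "\<And>y. y \<in> S \<Longrightarrow> (f has_derivative (\<lambda>h. g y \<bullet> h)) (at y)"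
    and g: "g x = p" "(g has_derivative (*v) M) (at x)"
    using assms unfolding has_2jet_def by blast
  have eq: "grad f y = g y" if "y \<in> S" for y
    using grad_eqI f that by blast
  show "grad f x = p" using eq S g by simp
  have "(grad f has_derivative (*v) M) (at x)"
    using has_derivative_transform_within_open[OF g(2) S] eq by simp
  then have "frechet_derivative (grad f) (at x) = (*v) M"
    using frechet_derivative_at by metis
  then show "hess f x = M" by (simp add: hess_def)
qed

lemma has_2jet_differentiable:
  assumes "has_2jet f x p M"
  shows "f differentiable (at x)" "grad f differentiable (at x)"
proof -
  obtain g S where S: "open S" "x \<in> S" and f: "\<And>y. y \<in> S \<Longrightarrow> (f has_derivative (\<lambda>h. g y \<bullet> h)) (at y)"
    and g: "(g has_derivative (*v) M) (at x)"
    using assms unfolding has_2jet_def by blast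
  show "f differentiable (at x)" using f S differentiable_def by blast
  have "grad f y = g y" if "y \<in> S" for y
    using grad_eqI f that by blast
  then show "grad f differentiable (at x)"
    using has_derivative_transform_within_open[OF g S, of "grad f"] differentiable_def by metis
qed

lemma C2_onI:
  assumes "\<And>x. x \<in> S \<Longrightarrow> has_2jet f x (p x) (M x)" "continuous_on S M"
  shows "C2_on S f"
proof -
  have "continuous_on S (hess f)"
    using assms(2) has_2jetD(2)[OF assms(1)] by (simp cong: continuous_on_cong)
  then show ?thesis
    unfolding C2_on_def using has_2jet_differentiable[OF assms(1)] by blast
qed

lemma C2_on_has_2jet:
  assumes "C2_on S f" "open S" "x \<in> S"
  shows "has_2jet f x (grad f x) (hess f x)"
  unfolding has_2jet_def
proof (intro exI conjI ballI)
  show "(f has_derivative (\<lambda>h. grad f y \<bullet> h)) (at y)" if "y \<in> S" for y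
    using assms that has_derivative_grad unfolding C2_on_def by blast
  let ?D = "frechet_derivative (grad f) (at x)"
  have D: "(grad f has_derivative ?D) (at x)"
    using assms frechet_derivative_works unfolding C2_on_def by blast
  then have "linear ?D" using has_derivative_bounded_linear bounded_linear.linear by blast
  then have "?D = (*v) (hess f x)"
    unfolding hess_def by (simp add: fun_eq_iff matrix_works)
  with D show "(grad f has_derivative (*v) (hess f x)) (at x)" by simp
qed (use assms in auto)

lemma has_2jet_continuous: "has_2jet f x p M \<Longrightarrow> isCont f x"
  unfolding has_2jet_def using has_derivative_continuous by blast

lemma C2_on_continuous:
  assumes "C2_on S f" "open S"
  shows "continuous_on S f" "continuous_on S (grad f)"
  using assms differentiable_imp_continuous_within
  unfolding C2_on_def continuous_on_eq_continuous_at[OF assms(2)] by blast+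

lemma has_2jet_add:
  assumes "has_2jet f x p M" "has_2jet g x q N"
  shows "has_2jet (\<lambda>y. f y + g y) x (p + q) (M + N)"
proof -
  obtain f' S where S: "open S" "x \<in> S" and f: "\<And>y. y \<in> S \<Longrightarrow> (f has_derivative (\<lambda>h. f' y \<bullet> h)) (at y)"
    and f': "f' x = p" "(f' has_derivative (*v) M) (at x)"
    using assms unfolding has_2jet_def by blast
  obtain g' T where T: "open T" "x \<in> T" and g: "\<And>y. y \<in> T \<Longrightarrow> (g has_derivative (\<lambda>h. g' y \<bullet> h)) (at y)"
    and g': "g' x = q" "(g' has_derivative (*v) N) (at x)"
    using assms unfolding has_2jet_def by blast
  show ?thesis unfolding has_2jet_def
  proof (intro exI conjI ballI)
    show "open (S \<inter> T)" "x \<in> S \<inter> T" using S T by auto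
    show "((\<lambda>y. f y + g y) has_derivative (\<lambda>h. (f' y + g' y) \<bullet> h)) (at y)" if "y \<in> S \<inter> T" for y
      using has_derivative_add[OF f g] that by (simp add: inner_add_left)
    show "f' x + g' x = p + q" using f' g' by simp
    show "((\<lambda>y. f' y + g' y) has_derivative (*v) (M + N)) (at x)"
      by (rule has_derivative_eq_rhs, rule has_derivative_add[OF f'(2) g'(2)])
         (simp add: fun_eq_iff matrix_vector_mult_add_rdistrib)
  qed
qed

lemma has_2jet_rescale:
  assumes "has_2jet f (\<mu> *\<^sub>R x + k) p M"
  shows "has_2jet (\<lambda>y. c * f (\<mu> *\<^sub>R y + k)) x ((c * \<mu>) *\<^sub>R p) ((c * \<mu>^2) *\<^sub>R M)"
proof -
  let ?A = "\<lambda>y. \<mu> *\<^sub>R y + k"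
  obtain g S where S: "open S" "?A x \<in> S" and f: "\<And>y. y \<in> S \<Longrightarrow> (f has_derivative (\<lambda>h. g y \<bullet> h)) (at y)"
    and g: "g (?A x) = p" "(g has_derivative (*v) M) (at (?A x))"
    using assms unfolding has_2jet_def by blast
  have A: "(?A has_derivative (\<lambda>h. \<mu> *\<^sub>R h)) (at y)" for y
    by (auto intro!: derivative_eq_intros)
  show ?thesis unfolding has_2jet_def
  proof (intro exI conjI ballI)
    show "open (?A -` S)" using S(1) by (intro open_vimage continuous_intros)
    show "x \<in> ?A -` S" using S by simp
    show "((\<lambda>y. c * f (?A y)) has_derivative (\<lambda>h. ((c * \<mu>) *\<^sub>R g (?A y)) \<bullet> h)) (at y)"
      if "y \<in> ?A -` S" for y
      using has_derivative_mult_right[OF has_derivative_compose[OF A f], of y c] that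
      by (simp add: mult.assoc)
    show "(c * \<mu>) *\<^sub>R g (?A x) = (c * \<mu>) *\<^sub>R p" using g by simp
    show "((\<lambda>y. (c * \<mu>) *\<^sub>R g (?A y)) has_derivative (*v) ((c * \<mu>^2) *\<^sub>R M)) (at x)"
      by (rule has_derivative_eq_rhs, rule has_derivative_scaleR_right[OF has_derivative_compose[OF A g(2)], of "c * \<mu>"])
         (simp add: fun_eq_iff matrix_vector_mult_scaleR scaleR_matrix_vector_assoc[symmetric] power2_eq_square
          algebra_simps)
  qed
qed

lemma has_2jet_cmult:
  "has_2jet f x p M \<Longrightarrow> has_2jet (\<lambda>y. c * f y) x (c *\<^sub>R p) (c *\<^sub>R M)"
  using has_2jet_rescale[of f 1 x 0] by simp

lemma has_2jet_diff:
  assumes "has_2jet f x p M" "has_2jet g x q N"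
  shows "has_2jet (\<lambda>y. f y - g y) x (p - q) (M - N)"
  using has_2jet_add[OF assms(1) has_2jet_cmult[OF assms(2), of "-1"]] by simp

lemma has_2jet_compose:
  fixes q :: "real^'n \<Rightarrow> real"
  assumes q: "has_2jet q x p M" and I: "open I" "q x \<in> I"
    and phi: "\<And>s. s \<in> I \<Longrightarrow> (\<phi> has_real_derivative \<phi>' s) (at s)"
    and phi1: "(\<phi>' has_real_derivative d) (at (q x))"
  shows "has_2jet (\<lambda>y. \<phi> (q y)) x (\<phi>' (q x) *\<^sub>R p) (\<phi>' (q x) *\<^sub>R M + d *\<^sub>R outer p)"
proof -
  obtain g S where S: "open S" "x \<in> S" and f: "\<And>y. y \<in> S \<Longrightarrow> (q has_derivative (\<lambda>h. g y \<bullet> h)) (at y)"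
    and g: "g x = p" "(g has_derivative (*v) M) (at x)"
    using q unfolding has_2jet_def by blast
  have "continuous_on S q"
    using f has_derivative_continuous S(1) continuous_on_eq_continuous_at by blast
  then have op: "open (S \<inter> q -` I)"
    using S(1) I(1) by (simp add: Int_commute continuous_on_open_vimage)
  show ?thesis unfolding has_2jet_def
  proof (intro exI conjI ballI)
    show "open (S \<inter> q -` I)" by (rule op)
    show "x \<in> S \<inter> q -` I" using S I by simp
    show "((\<lambda>y. \<phi> (q y)) has_derivative (\<lambda>h. (\<phi>' (q y) *\<^sub>R g y) \<bullet> h)) (at y)"
      if "y \<in> S \<inter> q -` I" for y
      using has_derivative_compose[OF f phi[unfolded has_field_derivative_def]] that by simp
    show "\<phi>' (q x) *\<^sub>R g x = \<phi>' (q x) *\<^sub>R p" using g by simp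
    have \<phi>': "((\<lambda>y. \<phi>' (q y)) has_derivative (\<lambda>h. d * (p \<bullet> h))) (at x)"
      using has_derivative_compose[OF f phi1[unfolded has_field_derivative_def]] S g by simp
    show "((\<lambda>y. \<phi>' (q y) *\<^sub>R g y) has_derivative (*v) (\<phi>' (q x) *\<^sub>R M + d *\<^sub>R outer p)) (at x)"
      by (rule has_derivative_eq_rhs, rule has_derivative_scaleR[OF \<phi>' g(2)])
         (simp add: fun_eq_iff g matrix_vector_mult_add_rdistrib scaleR_matrix_vector_assoc[symmetric] outer_mult_vec)
  qed
qed

lemma inner_symmetric_matrix:
  fixes M :: "real^'n^'n"
  assumes "transpose M = M"
  shows "x \<bullet> (M *v y) = (M *v x) \<bullet> y"
proof -
  have "M *v x = x v* M"
    using vector_transpose_matrix[of x M] unfolding assms by (rule sym)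
  then show ?thesis unfolding dot_lmul_matrix[symmetric] by (rule ssubst) (rule refl)
qed

lemma has_2jet_quadratic:
  fixes N :: "real^'n^'n"
  assumes "transpose N = N"
  shows "has_2jet (\<lambda>y. c + b \<bullet> (y - z) + (1/2) * ((y - z) \<bullet> (N *v (y - z)))) x (b + N *v (x - z)) N"
  unfolding has_2jet_def
proof (intro exI conjI ballI)
  show "open (UNIV :: (real^'n) set)" by simp
  have N: "bounded_linear ((*v) N)" by simp
  have D: "((\<lambda>y. N *v (y - z)) has_derivative (*v) N) (at y)" for y
    by (rule has_derivative_eq_rhs, rule bounded_linear.has_derivative[OF N])
       (auto intro!: derivative_eq_intros)
  show "((\<lambda>y. b + N *v (y - z)) has_derivative (*v) N) (at x)"
    by (rule has_derivative_eq_rhs, rule has_derivative_add[OF has_derivative_const D]) simp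
  show "((\<lambda>y. c + b \<bullet> (y - z) + (1/2) * ((y - z) \<bullet> (N *v (y - z)))) has_derivative
      (\<lambda>h. (b + N *v (y - z)) \<bullet> h)) (at y)" for y
  proof -
    have I: "((\<lambda>y. y - z) has_derivative (\<lambda>h. h)) (at y)"
      by (auto intro!: derivative_eq_intros)
    have "((\<lambda>y. c + b \<bullet> (y - z) + (1/2) * ((y - z) \<bullet> (N *v (y - z)))) has_derivative
        (\<lambda>h. 0 + b \<bullet> h + (1/2) * ((y - z) \<bullet> (N *v h) + h \<bullet> (N *v (y - z))))) (at y)"
      by (intro has_derivative_add has_derivative_const has_derivative_inner_right[OF I]
          has_derivative_mult_right has_derivative_inner[OF I D])
    moreover have "0 + b \<bullet> h + (1/2) * ((y - z) \<bullet> (N *v h) + h \<bullet> (N *v (y - z))) = (b + N *v (y - z)) \<bullet> h" for h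
      unfolding inner_symmetric_matrix[OF assms, of "y - z" h] inner_commute[of h]
      by (simp add: inner_add_left)
    ultimately show ?thesis
      by (rule has_derivative_eq_rhs[OF _ ext])
  qed
qed auto

text \<open>The second difference with increments \<open>t \<xi>\<close> and \<open>t \<eta>\<close> is \<open>t\<^sup>2 (M \<eta> \<bullet> \<xi>)\<close> to leading order: the mean value theorem
  along \<open>\<xi>\<close> turns it into a difference of the gradient field along \<open>\<eta>\<close>, to which differentiability at
  \<open>x\<close> applies. The difference itself is symmetric in \<open>\<xi>\<close> and \<open>\<eta>\<close>, so the leading coefficient is as
  well; this gives the symmetry of the Hessian.\<close>

lemma has_2jet_second_difference:
  fixes f :: "real^'n \<Rightarrow> real"
  assumes "has_2jet f x p M" "e > 0"
  shows "\<exists>d>0. \<forall>t. 0 < t \<and> t < d \<longrightarrow>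
    \<bar>f (x + t *\<^sub>R \<xi> + t *\<^sub>R \<eta>) - f (x + t *\<^sub>R \<xi>) - f (x + t *\<^sub>R \<eta>) + f x - t^2 * ((M *v \<eta>) \<bullet> \<xi>)\<bar> \<le> e * t^2"
proof -
  obtain g S where S: "open S" "x \<in> S" and f: "\<And>y. y \<in> S \<Longrightarrow> (f has_derivative (\<lambda>h. g y \<bullet> h)) (at y)"
    and g: "g x = p" "(g has_derivative (*v) M) (at x)"
    using assms unfolding has_2jet_def by blast
  define B where "B = 1 + norm \<xi> + norm \<eta>"
  have B: "B > 0" "norm \<xi> \<le> B" by (auto simp: B_def add_pos_nonneg)
  define e' where "e' = e / (2 * B^2)"
  have e': "e' > 0" using assms B by (simp add: e'_def)
  obtain d0 where d0: "d0 > 0" "\<And>y. norm (y - x) < d0 \<Longrightarrow> norm (g y - g x - M *v (y - x)) \<le> e' * norm (y - x)"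
    using g(2) e' unfolding has_derivative_at_alt by blast
  obtain r where r: "r > 0" "ball x r \<subseteq> S" using S open_contains_ball by blast
  define d where "d = min d0 r / B"
  show ?thesis
  proof (intro exI conjI allI impI)
    show "d > 0" using d0 r B by (simp add: d_def)
    fix t assume t: "0 < t \<and> t < d"
    then have tB: "t * B < min d0 r" using B by (simp add: d_def pos_less_divide_eq)
    have near: "norm (s *\<^sub>R \<xi> + k *\<^sub>R \<eta>) \<le> t * B" if "0 \<le> s" "s \<le> t" "0 \<le> k" "k \<le> t" for s k
    proof -
      have "norm (s *\<^sub>R \<xi> + k *\<^sub>R \<eta>) \<le> s * norm \<xi> + k * norm \<eta>"
        using norm_triangle_ineq[of "s *\<^sub>R \<xi>" "k *\<^sub>R \<eta>"] that by simp
      also have "\<dots> \<le> t * norm \<xi> + t * norm \<eta>" using that by (intro add_mono mult_right_mono) auto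
      also have "\<dots> \<le> t * B" using t by (simp add: B_def algebra_simps)
      finally show ?thesis .
    qed
    have inS: "x + s *\<^sub>R \<xi> + k *\<^sub>R \<eta> \<in> S" if "0 \<le> s" "s \<le> t" "0 \<le> k" "k \<le> t" for s k
      using near[OF that] tB r(2) by (auto simp: dist_norm add.assoc norm_minus_commute subset_iff)
    let ?\<phi> = "\<lambda>s. f (x + s *\<^sub>R \<xi> + t *\<^sub>R \<eta>) - f (x + s *\<^sub>R \<xi>)"
    let ?\<phi>' = "\<lambda>s. (g (x + s *\<^sub>R \<xi> + t *\<^sub>R \<eta>) - g (x + s *\<^sub>R \<xi>)) \<bullet> \<xi>"
    have "(?\<phi> has_derivative (\<lambda>h. ?\<phi>' s * h)) (at s within {0..t})" if "0 \<le> s" "s \<le> t" for s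
    proof -
      have 1: "((\<lambda>s. x + s *\<^sub>R \<xi> + t *\<^sub>R \<eta>) has_derivative (\<lambda>h. h *\<^sub>R \<xi>)) (at s within {0..t})"
        and 2: "((\<lambda>s. x + s *\<^sub>R \<xi>) has_derivative (\<lambda>h. h *\<^sub>R \<xi>)) (at s within {0..t})"
        by (auto intro!: derivative_eq_intros)
      have 3: "x + s *\<^sub>R \<xi> + t *\<^sub>R \<eta> \<in> S" "x + s *\<^sub>R \<xi> \<in> S"
        using inS[of s t] inS[of s 0] that t by auto
      show ?thesis
        by (rule has_derivative_eq_rhs, rule has_derivative_diff[OF has_derivative_compose[OF 1 f[OF 3(1)]]
              has_derivative_compose[OF 2 f[OF 3(2)]]])
           (simp add: inner_diff_left algebra_simps)
    qed
    then obtain s where s: "s \<in> {0<..<t}" "?\<phi> t - ?\<phi> 0 = ?\<phi>' s * (t - 0)"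
      using mvt_simple[of 0 t ?\<phi> "\<lambda>s h. ?\<phi>' s * h"] t by auto
    let ?y = "x + s *\<^sub>R \<xi> + t *\<^sub>R \<eta>" and ?z = "x + s *\<^sub>R \<xi>"
    have n: "norm (?y - x) \<le> t * B" "norm (?z - x) \<le> t * B"
      using near[of s t] near[of s 0] s(1) t by (auto simp: add.assoc)
    have 1: "norm (g ?y - g x - M *v (?y - x)) \<le> e' * (t * B)"
      using d0(2)[of ?y] n tB mult_left_mono[OF n(1), of e'] e' by linarith
    have 2: "norm (g ?z - g x - M *v (?z - x)) \<le> e' * (t * B)"
      using d0(2)[of ?z] n tB mult_left_mono[OF n(2), of e'] e' by linarith
    have eq: "g ?y - g ?z - t *\<^sub>R (M *v \<eta>) = (g ?y - g x - M *v (?y - x)) - (g ?z - g x - M *v (?z - x))"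
      by (simp add: matrix_vector_right_distrib matrix_vector_mult_scaleR algebra_simps)
    have "norm (g ?y - g ?z - t *\<^sub>R (M *v \<eta>)) \<le> 2 * (e' * (t * B))"
      unfolding eq using norm_triangle_ineq4 1 2 by (smt (verit))
    then have "\<bar>(g ?y - g ?z - t *\<^sub>R (M *v \<eta>)) \<bullet> \<xi>\<bar> \<le> 2 * (e' * (t * B)) * B"
      using Cauchy_Schwarz_ineq2[of "g ?y - g ?z - t *\<^sub>R (M *v \<eta>)" \<xi>] B mult_mono[of _ "2 * (e' * (t * B))" "norm \<xi>" B]
        e' t by (smt (verit) norm_ge_zero mult_nonneg_nonneg)
    also have "\<dots> = e * t" using B by (simp add: e'_def power2_eq_square field_simps)
    finally have "\<bar>?\<phi>' s - t * ((M *v \<eta>) \<bullet> \<xi>)\<bar> * t \<le> e * t * t"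
      using t by (intro mult_right_mono) (auto simp: inner_diff_left)
    moreover have "f (x + t *\<^sub>R \<xi> + t *\<^sub>R \<eta>) - f (x + t *\<^sub>R \<xi>) - f (x + t *\<^sub>R \<eta>) + f x = ?\<phi>' s * t"
      using s by simp
    moreover have "?\<phi>' s * t - t^2 * ((M *v \<eta>) \<bullet> \<xi>) = (?\<phi>' s - t * ((M *v \<eta>) \<bullet> \<xi>)) * t"
      by (simp add: left_diff_distrib power2_eq_square)
    then have "\<bar>?\<phi>' s * t - t^2 * ((M *v \<eta>) \<bullet> \<xi>)\<bar> = \<bar>?\<phi>' s - t * ((M *v \<eta>) \<bullet> \<xi>)\<bar> * t"
      using t by (simp only: abs_mult) simp
    ultimately show "\<bar>f (x + t *\<^sub>R \<xi> + t *\<^sub>R \<eta>) - f (x + t *\<^sub>R \<xi>) - f (x + t *\<^sub>R \<eta>) + f x - t^2 * ((M *v \<eta>) \<bullet> \<xi>)\<bar> \<le> e * t^2"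
      by (simp add: power2_eq_square mult.assoc)
  qed
qed

lemma has_2jet_symmetric:
  fixes f :: "real^'n \<Rightarrow> real"
  assumes "has_2jet f x p M"
  shows "transpose M = M"
proof -
  have sym: "(M *v \<eta>) \<bullet> \<xi> = (M *v \<xi>) \<bullet> \<eta>" for \<xi> \<eta>
  proof -
    have "\<bar>(M *v \<eta>) \<bullet> \<xi> - (M *v \<xi>) \<bullet> \<eta>\<bar> \<le> e" if "e > 0" for e
    proof -
      have e2: "e / 2 > 0" using that by simp
      obtain d1 where d1: "d1 > 0" "\<And>t. 0 < t \<and> t < d1 \<Longrightarrow>
         \<bar>f (x + t *\<^sub>R \<xi> + t *\<^sub>R \<eta>) - f (x + t *\<^sub>R \<xi>) - f (x + t *\<^sub>R \<eta>) + f x - t^2 * ((M *v \<eta>) \<bullet> \<xi>)\<bar> \<le> e/2 * t^2"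
        using has_2jet_second_difference[OF assms e2] by meson
      obtain d2 where d2: "d2 > 0" "\<And>t. 0 < t \<and> t < d2 \<Longrightarrow>
         \<bar>f (x + t *\<^sub>R \<eta> + t *\<^sub>R \<xi>) - f (x + t *\<^sub>R \<eta>) - f (x + t *\<^sub>R \<xi>) + f x - t^2 * ((M *v \<xi>) \<bullet> \<eta>)\<bar> \<le> e/2 * t^2"
        using has_2jet_second_difference[OF assms e2] by meson
      define t where "t = min d1 d2 / 2"
      have t: "0 < t" "t < d1" "t < d2" using d1 d2 by (auto simp: t_def)
      have eq: "x + t *\<^sub>R \<eta> + t *\<^sub>R \<xi> = x + t *\<^sub>R \<xi> + t *\<^sub>R \<eta>" by simp
      have tri: "\<bar>a - b\<bar> \<le> e * t^2" if "\<bar>p - q - r + s - a\<bar> \<le> e/2 * t^2" "\<bar>p - r - q + s - b\<bar> \<le> e/2 * t^2"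
        for a b p q r s :: real
      proof -
        have "e * t^2 = e/2 * t^2 + e/2 * t^2" by simp
        then show ?thesis using that by linarith
      qed
      have "\<bar>t^2 * ((M *v \<eta>) \<bullet> \<xi>) - t^2 * ((M *v \<xi>) \<bullet> \<eta>)\<bar> \<le> e * t^2"
      proof (rule tri)
        show "\<bar>f (x + t *\<^sub>R \<xi> + t *\<^sub>R \<eta>) - f (x + t *\<^sub>R \<xi>) - f (x + t *\<^sub>R \<eta>) + f x - t^2 * ((M *v \<eta>) \<bullet> \<xi>)\<bar> \<le> e/2 * t^2"
          using d1(2) t by blast
        show "\<bar>f (x + t *\<^sub>R \<xi> + t *\<^sub>R \<eta>) - f (x + t *\<^sub>R \<eta>) - f (x + t *\<^sub>R \<xi>) + f x - t^2 * ((M *v \<xi>) \<bullet> \<eta>)\<bar> \<le> e/2 * t^2"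
          using d2(2)[of t] t unfolding eq by blast
      qed
      then have "t^2 * \<bar>(M *v \<eta>) \<bullet> \<xi> - (M *v \<xi>) \<bullet> \<eta>\<bar> \<le> t^2 * e"
        by (metis abs_mult abs_power2 mult.commute right_diff_distrib)
      then show ?thesis using t by simp
    qed
    then have "\<bar>(M *v \<eta>) \<bullet> \<xi> - (M *v \<xi>) \<bullet> \<eta>\<bar> \<le> 0"
      using field_le_epsilon[of "\<bar>(M *v \<eta>) \<bullet> \<xi> - (M *v \<xi>) \<bullet> \<eta>\<bar>" 0] by simp
    then show ?thesis by simp
  qed
  show ?thesis
  proof (simp add: vec_eq_iff transpose_def, intro allI)
    fix i j
    show "M $ j $ i = M $ i $ j"
      using sym[of "axis i 1" "axis j 1"] by (simp add: matrix_vector_mul_component inner_axis)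
  qed
qed

text \<open>If \<open>\<xi> \<bullet> M \<xi>\<close> were negative, the slope of \<open>f\<close> along \<open>\<xi>\<close>, which vanishes at \<open>x\<close>, would be
  negative just after, and \<open>f\<close> would drop below \<open>f x\<close>.\<close>

lemma has_2jet_local_min:
  fixes f :: "real^'n \<Rightarrow> real"
  assumes "has_2jet f x p M" "open U" "x \<in> U" "\<And>y. y \<in> U \<Longrightarrow> f x \<le> f y"
  shows "p = 0" "\<xi> \<bullet> (M *v \<xi>) \<ge> 0"
proof -
  obtain g S where S: "open S" "x \<in> S" and f: "\<And>y. y \<in> S \<Longrightarrow> (f has_derivative (\<lambda>h. g y \<bullet> h)) (at y)"
    and g: "g x = p" "(g has_derivative (*v) M) (at x)"
    using assms unfolding has_2jet_def by blast
  have "\<forall>\<^sub>F y in at x. f x \<le> f y"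
    using assms(2-4) eventually_at_topological by blast
  from has_derivative_local_min[OF f[OF S(2)] this]
  have "p \<bullet> p = 0" using g by metis
  then show p: "p = 0" by simp
  show "\<xi> \<bullet> (M *v \<xi>) \<ge> 0"
  proof (rule ccontr)
    assume neg: "\<not> ?thesis"
    let ?h = "\<lambda>t. x + t *\<^sub>R \<xi>"
    have op: "open (?h -` (S \<inter> U))"
      using S assms(2) by (intro open_vimage continuous_intros) auto
    moreover have "0 \<in> ?h -` (S \<inter> U)" using S assms by simp
    ultimately obtain r where r: "r > 0" "ball 0 r \<subseteq> ?h -` (S \<inter> U)"
      using open_contains_ball by blast
    have h: "(?h has_derivative (\<lambda>s. s *\<^sub>R \<xi>)) (at t)" for t
      by (auto intro!: derivative_eq_intros)
    have 1: "((\<lambda>t. f (?h t)) has_real_derivative (g (?h t) \<bullet> \<xi>)) (at t)" if "\<bar>t\<bar> < r" for t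
    proof -
      have "?h t \<in> S" using r that by (auto simp: subset_iff dist_norm)
      from has_derivative_compose[OF h f[OF this]]
      show ?thesis unfolding has_field_derivative_def
        by (rule has_derivative_eq_rhs) (simp add: fun_eq_iff mult.commute)
    qed
    have "(g has_derivative (*v) M) (at (?h 0))" using g by simp
    from has_derivative_inner_left[OF has_derivative_compose[OF h this], of \<xi>]
    have 2: "((\<lambda>t. g (?h t) \<bullet> \<xi>) has_real_derivative (\<xi> \<bullet> (M *v \<xi>))) (at 0)"
      unfolding has_field_derivative_def
      by (rule has_derivative_eq_rhs) (simp add: fun_eq_iff matrix_vector_mult_scaleR inner_commute mult.commute)
    obtain d where d: "d > 0" "\<And>t. 0 < t \<Longrightarrow> t < d \<Longrightarrow> g (?h t) \<bullet> \<xi> < 0"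
      using DERIV_neg_dec_right[OF 2] neg g p by auto
    define t where "t = min d r / 2"
    have t: "0 < t" "t < d" "t < r" using d r by (auto simp: t_def)
    obtain s where s: "0 < s" "s < t" "f (?h t) - f (?h 0) = (t - 0) * (g (?h s) \<bullet> \<xi>)"
      using MVT2[of 0 t "\<lambda>t. f (?h t)" "\<lambda>t. g (?h t) \<bullet> \<xi>"] 1 t by force
    have "g (?h s) \<bullet> \<xi> < 0" using d s t by simp
    then have "f (?h t) < f x" using s t mult_pos_neg[of t "g (?h s) \<bullet> \<xi>"] by simp
    moreover have "?h t \<in> U" using r(2) t by (auto simp: subset_iff dist_norm)
    ultimately show False using assms(4) by fastforce
  qed
qed

section \<open>Pairing of positive semidefinite matrices\<close>

lemma inner_outer: "A \<bullet> outer x = x \<bullet> (A *v x)"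
  by (simp add: inner_vec_def outer_def matrix_vector_mult_def sum_distrib_left mult_ac)

lemma norm_outer: "norm (outer x) = (norm x)^2"
proof -
  have "outer x \<bullet> outer x = ((norm x)^2)^2"
    by (simp add: inner_outer outer_mult_vec power2_norm_eq_inner) (simp add: power2_eq_square)
  then show ?thesis by (simp add: norm_eq_sqrt_inner)
qed

lemma transpose_outer: "transpose (outer x) = outer x"
  by (simp add: transpose_def outer_def vec_eq_iff mult.commute)

lemma transpose_add: "transpose (A + B) = transpose A + transpose (B :: real^'n^'n)"
  by (simp add: transpose_def vec_eq_iff)

lemma transpose_scaleR: "transpose (c *\<^sub>R A) = c *\<^sub>R transpose (A :: real^'n^'n)"
  by (simp add: transpose_def vec_eq_iff)

lemma matrix_eq_0_if_axis: 
  fixes P :: "real^'n^'n"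
  assumes "\<And>i. P *v axis i 1 = 0" shows "P = 0"
  using assms by (simp add: matrix_vector_mul_component vec_eq_iff inner_axis)

text \<open>Columns of \<open>P\<close> are cleared one at a time: if \<open>c = P e\<close> is a nonzero column then
  \<open>P - c c\<^sup>T / (e \<bullet> c)\<close> is still positive semidefinite and kills \<open>e\<close>, and the rank one matrix
  that was split off pairs with \<open>A\<close> to a multiple of \<open>c \<bullet> A c\<close>.\<close>

lemma psd_inner_nonneg:
  fixes A P :: "real^'n^'n"
  assumes A: "\<And>x. x \<bullet> (A *v x) \<ge> 0"
    and P: "transpose P = P" "\<And>x. x \<bullet> (P *v x) \<ge> 0"
  shows "A \<bullet> P \<ge> 0"
proof -
  have "A \<bullet> P \<ge> 0"
    if "transpose P = P" "\<And>x. x \<bullet> (P *v x) \<ge> 0" "\<And>i. i \<notin> S \<Longrightarrow> P *v axis i 1 = 0" "finite S"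
    for S and P :: "real^'n^'n"
    using that(4,1,2,3)
  proof (induction S arbitrary: P rule: finite_induct)
    case empty
    then have "P = 0" using matrix_eq_0_if_axis by blast
    then show ?case by simp
  next
    case (insert i S)
    define e :: "real^'n" where "e = axis i 1"
    define c where "c = P *v e"
    define d where "d = e \<bullet> c"
    note sym = inner_symmetric_matrix[OF insert.prems(1)]
    show ?case
    proof (cases "c = 0")
      case True
      then have "P *v axis j 1 = 0" if "j \<notin> S" for j
        using insert.prems(3)[of j] that by (cases "j = i") (auto simp: c_def e_def)
      then show ?thesis using insert.IH insert.prems by blast
    next
      case False
      have quad: "(s *\<^sub>R e + x) \<bullet> (P *v (s *\<^sub>R e + x)) = s^2 * d + 2 * s * (c \<bullet> x) + x \<bullet> (P *v x)" for s x
        using sym[of e x] sym[of x e]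
        by (simp add: matrix_vector_right_distrib matrix_vector_mult_scaleR inner_add_left inner_add_right
            c_def d_def power2_eq_square inner_commute algebra_simps)
      have "d \<noteq> 0"
      proof
        assume d: "d = 0"
        define s where "s = - (c \<bullet> (P *v c) + 1) / (2 * (c \<bullet> c))"
        have "2 * s * (c \<bullet> c) = - (c \<bullet> (P *v c) + 1)"
          using False by (simp add: s_def)
        then show False
          using insert.prems(2)[of "s *\<^sub>R e + c"] quad[of s c] d by simp
      qed
      moreover have "d \<ge> 0" using insert.prems(2)[of e] by (simp add: d_def c_def)
      ultimately have d: "d > 0" by simp
      define Q where "Q = P + (- 1 / d) *\<^sub>R outer c"
      have Qx: "Q *v x = P *v x - ((c \<bullet> x) / d) *\<^sub>R c" for x
        unfolding Q_def matrix_vector_mult_add_rdistrib scaleR_matrix_vector_assoc[symmetric] outer_mult_vec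
        by simp
      have "A \<bullet> Q \<ge> 0"
      proof (rule insert.IH)
        show "transpose Q = Q"
          unfolding Q_def transpose_add transpose_scaleR transpose_outer insert.prems(1) ..
        show "x \<bullet> (Q *v x) \<ge> 0" for x
        proof -
          have "0 \<le> (- (c \<bullet> x) / d)^2 * d + 2 * (- (c \<bullet> x) / d) * (c \<bullet> x) + x \<bullet> (P *v x)"
            using insert.prems(2)[of "(- (c \<bullet> x) / d) *\<^sub>R e + x"] unfolding quad .
          also have "\<dots> = x \<bullet> (P *v x) - (c \<bullet> x)^2 / d"
            using d by (simp add: power2_eq_square field_simps)
          also have "\<dots> = x \<bullet> (Q *v x)"
            by (simp add: Qx inner_diff_right inner_commute power2_eq_square)
          finally show ?thesis .
        qed
        show "Q *v axis j 1 = 0" if "j \<notin> S" for j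
        proof (cases "j = i")
          case True
          then have "axis j 1 = e" by (simp add: e_def)
          then show ?thesis using d by (simp add: Qx d_def inner_commute flip: c_def)
        next
          case False
          then have "P *v axis j 1 = 0" using insert.prems(3) that by blast
          moreover from this have "c \<bullet> axis j 1 = 0" using sym[of e "axis j 1"] by (simp add: c_def)
          ultimately show ?thesis by (simp add: Qx)
        qed
      qed
      moreover have "A \<bullet> P = A \<bullet> Q + (1 / d) * (c \<bullet> (A *v c))"
        unfolding Q_def inner_add_right inner_scaleR_right inner_outer by simp
      ultimately show ?thesis using A[of c] d by simp
    qed
  qed
  from this[of P UNIV] show ?thesis using P by simp
qed

section \<open>The operator\<close>

lemma sym_mats_subspace: "subspace (sym_mats :: (real^'n^'n) set)"
  by (auto simp: subspace_def sym_mats_def transpose_add transpose_scaleR) (simp add: transpose_def vec_eq_iff)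

lemma mat_1_in_sym_mats: "mat 1 \<in> sym_mats"
  by (simp add: sym_mats_def)

lemma sym_unit_in_sym_mats: "sym_unit i j \<in> sym_mats"
  by (simp add: sym_mats_def sym_unit_def transpose_def vec_eq_iff axis_def)

text \<open>The directions in which \<open>dT_mat\<close> differentiates span the symmetric matrices, and the
  coordinates of \<open>H\<close> with respect to them are its entries. So the pairing of \<open>dT_mat\<close> with \<open>H\<close> is the
  derivative of the operator in direction \<open>H\<close>.\<close>

lemma sym_mats_expansion:
  assumes "H \<in> sym_mats"
  shows "H = (\<Sum>i\<in>UNIV. \<Sum>j\<in>UNIV. H$i$j *\<^sub>R sym_unit i j)"
proof -
  have H: "H$i$j = H$j$i" for i j
    using assms by (simp add: sym_mats_def transpose_def vec_eq_iff)
  have "(\<Sum>i\<in>UNIV. \<Sum>j\<in>UNIV. H$i$j *\<^sub>R sym_unit i j) $ k $ l = H$k$l" for k l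
  proof -
    have "H$i$j * sym_unit i j $ k $ l =
       (if j = l then if i = k then H$k$l/2 else 0 else 0) + (if j = k then if i = l then H$k$l/2 else 0 else 0)" for i j
      using H by (auto simp: sym_unit_def axis_def)
    then show ?thesis by (simp add: sum.distrib)
  qed
  then show ?thesis by (simp add: vec_eq_iff)
qed

lemma jet_domain_convex: "convex (jet_domain :: (real \<times> (real^'n) \<times> (real^'n^'n)) set)"
  unfolding jet_domain_def
  by (intro convex_Times convex_real_interval convex_UNIV subspace_imp_convex sym_mats_subspace)

definition has_jet_gradient :: "(real \<times> (real^'n) \<times> (real^'n^'n) \<Rightarrow> real) \<Rightarrow>
    (real \<times> (real^'n) \<times> (real^'n^'n) \<Rightarrow> (real \<times> (real^'n) \<times> (real^'n^'n)) \<Rightarrow>\<^sub>L real) \<Rightarrow> bool" where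
  "has_jet_gradient T F \<longleftrightarrow> continuous_on jet_domain F \<and>
    (\<forall>q\<in>jet_domain. (T has_derivative blinfun_apply (F q)) (at q within jet_domain))"

lemma derivative_along_segment:
  assumes F: "has_jet_gradient T F"
    and seg: "\<And>t. t \<in> I \<Longrightarrow> q + t *\<^sub>R d \<in> jet_domain" and "t \<in> I"
  shows "((\<lambda>t. T (q + t *\<^sub>R d)) has_derivative (\<lambda>h. h * F (q + t *\<^sub>R d) d)) (at t within I)"
proof -
  have g: "((\<lambda>t. q + t *\<^sub>R d) has_derivative (\<lambda>h. h *\<^sub>R d)) (at t within I)"
    by (auto intro!: derivative_eq_intros)
  have "(T has_derivative F (q + t *\<^sub>R d)) (at (q + t *\<^sub>R d) within (\<lambda>t. q + t *\<^sub>R d) ` I)"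
    using F seg assms(3) unfolding has_jet_gradient_def by (blast intro: has_derivative_subset)
  from has_derivative_in_compose[OF g this] show ?thesis
    by (simp add: blinfun.scaleR_right)
qed

lemma jet_mean_value:
  assumes F: "has_jet_gradient T F" and q: "q \<in> jet_domain" "q + d \<in> jet_domain"
  obtains t where "0 \<le> t" "t \<le> 1" "q + t *\<^sub>R d \<in> jet_domain" "T (q + d) - T q = F (q + t *\<^sub>R d) d"
proof -
  have seg: "q + t *\<^sub>R d \<in> jet_domain" if "t \<in> {0..1}" for t
  proof -
    have "(1 - t) *\<^sub>R q + t *\<^sub>R (q + d) \<in> jet_domain"
      using jet_domain_convex q that unfolding convex_def by (metis atLeastAtMost_iff diff_add_cancel diff_ge_0_iff_ge)
    then show ?thesis by (simp add: algebra_simps)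
  qed
  have "((\<lambda>t. T (q + t *\<^sub>R d)) has_derivative (\<lambda>h. h * F (q + t *\<^sub>R d) d)) (at t within {0..1})"
    if "0 \<le> t" "t \<le> 1" for t
    by (rule derivative_along_segment[OF F seg]) (use that in auto)
  from mvt_very_simple[OF zero_le_one this]
  obtain t where "t \<in> {0..1}" "T (q + 1 *\<^sub>R d) - T (q + 0 *\<^sub>R d) = (1 - 0) * F (q + t *\<^sub>R d) d"
    by blast
  then show ?thesis using that[of t] seg[of t] by simp
qed

lemma derivative_eq_dT_mat:
  fixes q :: "real \<times> (real^'n) \<times> (real^'n^'n)"
  assumes F: "has_jet_gradient T F" and q: "q \<in> jet_domain" and H: "H \<in> sym_mats"
  shows "F q (0, 0, H) = dT_mat T q \<bullet> H"
proof -
  obtain s p M where qs: "q = (s, p, M)" by (metis surj_pair)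
  have unit: "F q (0, 0, sym_unit i j) = dT_mat T q $ i $ j" for i j
  proof -
    have "q + t *\<^sub>R (0, 0, sym_unit i j) \<in> jet_domain" for t
      using q sym_mats_subspace sym_unit_in_sym_mats[of i j]
      by (auto simp: qs jet_domain_def subspace_def)
    from derivative_along_segment[OF F this, where t=0 and I=UNIV]
    have "((\<lambda>t. T (q + t *\<^sub>R (0, 0, sym_unit i j))) has_real_derivative F q (0, 0, sym_unit i j)) (at 0)"
      unfolding has_field_derivative_def
      by (rule has_derivative_eq_rhs)
         (simp_all only: UNIV_I scaleR_zero_left add_0_right mult.commute fun_eq_iff simp_thms)
    then show ?thesis by (simp add: dT_mat_def qs DERIV_imp_deriv)
  qed
  have lin: "linear (\<lambda>H. F q (0, 0, H))"
  proof (rule linearI)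
    show "F q (0, 0, A + B) = F q (0, 0, A) + F q (0, 0, B)" for A B
      using blinfun.add_right[of "F q" "(0, 0, A)" "(0, 0, B)"] by simp
    show "F q (0, 0, c *\<^sub>R A) = c *\<^sub>R F q (0, 0, A)" for c A
      using blinfun.scaleR_right[of "F q" c "(0, 0, A)"] by simp
  qed
  have "F q (0, 0, H) = F q (0, 0, \<Sum>i\<in>UNIV. \<Sum>j\<in>UNIV. H$i$j *\<^sub>R sym_unit i j)"
    using sym_mats_expansion[OF H] by simp
  also have "\<dots> = dT_mat T q \<bullet> H"
    by (simp add: linear_sum[OF lin] linear_scale[OF lin] unit inner_vec_def mult.commute)
  finally show ?thesis .
qed

lemma C1_on_obtains_gradient:
  assumes "C1_on jet_domain T" obtains F where "has_jet_gradient T F"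
  using assms unfolding C1_on_def has_jet_gradient_def by blast

text \<open>The sign convention makes the operator behave like \<open>- \<Delta>\<close>: enlarging the Hessian lowers it. The
  derivative along \<open>P\<close> is the pairing of a negative definite matrix with a positive semidefinite one.\<close>

lemma elliptic_decreasing:
  assumes C1: "C1_on jet_domain T" and ell: "elliptic T"
    and q: "(s, p, M) \<in> jet_domain" and P: "transpose P = P" "\<And>x. x \<bullet> (P *v x) \<ge> 0"
  shows "T (s, p, M + P) \<le> T (s, p, M)"
proof -
  obtain F where F: "has_jet_gradient T F" using C1_on_obtains_gradient[OF C1] .
  have P': "P \<in> sym_mats" using P by (simp add: sym_mats_def)
  have q': "(s, p, M) + (0, 0, P) \<in> jet_domain"
    using q P by (simp add: jet_domain_def sym_mats_def transpose_add)
  from jet_mean_value[OF F q q'] obtain t where t: "(s, p, M) + t *\<^sub>R (0, 0, P) \<in> jet_domain"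
    "T ((s, p, M) + (0, 0, P)) - T (s, p, M) = F ((s, p, M) + t *\<^sub>R (0, 0, P)) (0, 0, P)"
    by blast
  let ?D = "dT_mat T ((s, p, M) + t *\<^sub>R (0, 0, P))"
  have "pos_def (- ?D)" using ell t unfolding elliptic_def by blast
  then have "x \<bullet> ((- ?D) *v x) \<ge> 0" for x
    unfolding pos_def_def by (cases "x = 0") (auto intro: less_imp_le)
  from psd_inner_nonneg[OF this P] have "?D \<bullet> P \<le> 0" by simp
  then show ?thesis using t derivative_eq_dT_mat[OF F t(1) P'] by simp
qed

text \<open>The linearisation argument behind the comparison principles, as one inequality: near a given
  jet the lower order part of the derivative is bounded by \<open>C\<close> and its matrix part is uniformly negative
  definite with constant \<open>\<theta>\<close>. Hessian increments have the shape \<open>k x x\<^sup>T - \<beta> I\<close> because this is the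
  Hessian of a Gaussian, which serves as barrier.\<close>

lemma elliptic_local_estimate:
  fixes T :: "real \<times> (real^'n) \<times> (real^'n^'n) \<Rightarrow> real"
  assumes C1: "C1_on jet_domain T" and ell: "elliptic T" and q0: "q0 \<in> jet_domain"
  obtains \<eta> \<theta> C where "\<eta> > 0" "\<theta> > 0" "C > 0"
    "\<And>q s p x k \<beta>. \<lbrakk>q \<in> jet_domain; q + (s, p, k *\<^sub>R outer x - \<beta> *\<^sub>R mat 1) \<in> jet_domain;
       dist q q0 < \<eta>; dist (q + (s, p, k *\<^sub>R outer x - \<beta> *\<^sub>R mat 1)) q0 < \<eta>; k \<ge> 0; \<beta> \<ge> 0\<rbrakk> \<Longrightarrow>
       T (q + (s, p, k *\<^sub>R outer x - \<beta> *\<^sub>R mat 1)) \<le> T q + C * (\<bar>s\<bar> + norm p + \<beta>) - k * \<theta> * (norm x)^2"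
proof -
  obtain F where F: "has_jet_gradient T F" using C1_on_obtains_gradient[OF C1] .
  define D0 where "D0 = dT_mat T q0"
  have pd: "pos_def (- D0)" using ell q0 by (simp add: elliptic_def D0_def)
  have "continuous_on (sphere 0 1) (\<lambda>x::real^'n. x \<bullet> ((- D0) *v x))"
    by (intro continuous_intros linear_continuous_on matrix_vector_mul_bounded_linear)
  moreover have "axis undefined 1 \<in> sphere (0::real^'n) 1" by simp
  ultimately obtain x0 :: "real^'n" where x0: "x0 \<in> sphere 0 1"
    "\<And>x. x \<in> sphere 0 1 \<Longrightarrow> x0 \<bullet> ((- D0) *v x0) \<le> x \<bullet> ((- D0) *v x)"
    using continuous_attains_inf[of "sphere (0::real^'n) 1" "\<lambda>x. x \<bullet> ((- D0) *v x)"] by auto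
  define \<theta> where "\<theta> = x0 \<bullet> ((- D0) *v x0) / 2"
  have \<theta>: "\<theta> > 0" using pd x0(1) unfolding \<theta>_def pos_def_def by (metis half_gt_zero norm_zero zero_neq_one mem_sphere_0)
  have D0: "D0 \<bullet> outer x \<le> - 2 * \<theta> * (norm x)^2" for x
  proof (cases "x = 0")
    case True
    then show ?thesis by (simp add: inner_outer)
  next
    case False
    define y where "y = (1 / norm x) *\<^sub>R x"
    have "2 * \<theta> \<le> y \<bullet> ((- D0) *v y)" using x0(2)[of y] False by (simp add: \<theta>_def y_def)
    also have "\<dots> = (1 / norm x)^2 * (x \<bullet> ((- D0) *v x))"
      by (simp add: y_def matrix_vector_mult_scaleR power2_eq_square)
    finally have "2 * \<theta> * (norm x)^2 \<le> x \<bullet> ((- D0) *v x)"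
      using False by (simp add: power_divide field_simps)
    then show ?thesis by (simp flip: inner_outer)
  qed
  have contF: "continuous_on jet_domain F" using F by (simp add: has_jet_gradient_def)
  have "continuous_on jet_domain (\<lambda>q. \<chi> i j. F q (0, 0, sym_unit i j))"
    by (intro continuous_on_vec_lambda bounded_bilinear.continuous_on[OF bounded_bilinear_blinfun_apply] contF continuous_intros)
  moreover have "F q (0, 0, sym_unit i j) = dT_mat T q $ i $ j" if "q \<in> jet_domain" for q i j
  proof -
    have "F q (0, 0, sym_unit i j) = dT_mat T q \<bullet> sym_unit i j"
      by (rule derivative_eq_dT_mat[OF F that sym_unit_in_sym_mats])
    also have "\<dots> = (dT_mat T q $ i $ j + dT_mat T q $ j $ i) / 2"
      by (simp add: sym_unit_def inner_add_right inner_axis)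
    also have "dT_mat T q $ j $ i = dT_mat T q $ i $ j"
      using ell that by (auto simp: elliptic_def pos_def_def transpose_def vec_eq_iff)
    finally show ?thesis by simp
  qed
  ultimately have contD: "continuous_on jet_domain (dT_mat T)"
    by (simp add: vec_lambda_eta cong: continuous_on_cong)
  obtain \<eta>1 where \<eta>1: "\<eta>1 > 0" "\<And>q. q \<in> jet_domain \<Longrightarrow> dist q q0 < \<eta>1 \<Longrightarrow> dist (dT_mat T q) D0 < \<theta>"
    using contD q0 \<theta> unfolding continuous_on_iff D0_def by metis
  obtain \<eta>2 where \<eta>2: "\<eta>2 > 0" "\<And>q. q \<in> jet_domain \<Longrightarrow> dist q q0 < \<eta>2 \<Longrightarrow> dist (F q) (F q0) < 1"
    using contF q0 zero_less_one unfolding continuous_on_iff by metis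
  define C where "C = norm (F q0) + 1 + (norm D0 + \<theta>) * norm (mat 1 :: real^'n^'n)"
  have C: "C > 0" using \<theta> by (simp add: C_def add_nonneg_pos add_pos_nonneg)
  show ?thesis
  proof (rule that[of "min \<eta>1 \<eta>2" \<theta> C])
    fix q :: "real \<times> (real^'n) \<times> (real^'n^'n)" and s p x k \<beta>
    let ?H = "k *\<^sub>R outer x - \<beta> *\<^sub>R (mat 1 :: real^'n^'n)"
    assume q: "q \<in> jet_domain" "q + (s, p, ?H) \<in> jet_domain" "dist q q0 < min \<eta>1 \<eta>2"
      "dist (q + (s, p, ?H)) q0 < min \<eta>1 \<eta>2" and nn: "k \<ge> 0" "\<beta> \<ge> 0"
    obtain t where t: "0 \<le> t" "t \<le> 1" "q + t *\<^sub>R (s, p, ?H) \<in> jet_domain"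
      "T (q + (s, p, ?H)) - T q = F (q + t *\<^sub>R (s, p, ?H)) (s, p, ?H)"
      using jet_mean_value[OF F q(1,2)] .
    define q' where "q' = q + t *\<^sub>R (s, p, ?H)"
    have "q' = (1 - t) *\<^sub>R q + t *\<^sub>R (q + (s, p, ?H))"
      unfolding q'_def by (simp add: algebra_simps)
    also have "\<dots> \<in> ball q0 (min \<eta>1 \<eta>2)"
      using convex_ball[of q0 "min \<eta>1 \<eta>2", unfolded convex_def] q t by (simp add: dist_commute)
    finally have near: "dist q' q0 < \<eta>1" "dist q' q0 < \<eta>2" by (auto simp: dist_commute)
    have q'd: "q' \<in> jet_domain" using t by (simp add: q'_def)
    have F': "norm (F q') \<le> norm (F q0) + 1"
      using \<eta>2(2)[OF q'd near(2)] norm_triangle_ineq2[of "F q'" "F q0"] by (simp add: dist_norm)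
    define E where "E = dT_mat T q' - D0"
    have E: "norm E \<le> \<theta>" using \<eta>1(2)[OF q'd near(1)] by (simp add: dist_norm E_def)
    have "F q' (s, p, ?H) = F q' ((s, p, 0) + (0, 0, ?H))" by simp
    also have "\<dots> = F q' (s, p, 0) + F q' (0, 0, ?H)" by (rule blinfun.add_right)
    also have "F q' (0, 0, ?H) = dT_mat T q' \<bullet> ?H"
      by (intro derivative_eq_dT_mat[OF F q'd] subspace_diff[OF sym_mats_subspace]
          subspace_scale[OF sym_mats_subspace] mat_1_in_sym_mats)
         (simp add: sym_mats_def transpose_outer)
    also have "\<dots> = k * (D0 \<bullet> outer x) + k * (E \<bullet> outer x) - \<beta> * (dT_mat T q' \<bullet> mat 1)"
      by (simp add: E_def inner_diff_right inner_diff_left algebra_simps)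
    finally have "F q' (s, p, ?H) = F q' (s, p, 0) +
      (k * (D0 \<bullet> outer x) + k * (E \<bullet> outer x) - \<beta> * (dT_mat T q' \<bullet> mat 1))" .
    moreover have "F q' (s, p, 0) \<le> (norm (F q0) + 1) * (\<bar>s\<bar> + norm p)"
    proof -
      have n: "norm (s, p, 0 :: real^'n^'n) \<le> \<bar>s\<bar> + norm p"
        using norm_Pair_le[of s "(p, 0 :: real^'n^'n)"] norm_Pair_le[of p "0 :: real^'n^'n"] by simp
      have "F q' (s, p, 0) \<le> norm (F q' (s, p, 0))" by simp
      also have "\<dots> \<le> norm (F q') * norm (s, p, 0 :: real^'n^'n)" by (rule norm_blinfun)
      also have "\<dots> \<le> (norm (F q0) + 1) * (\<bar>s\<bar> + norm p)"
        by (rule mult_mono[OF F' n]) auto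
      finally show ?thesis .
    qed
    moreover have "k * (D0 \<bullet> outer x) \<le> k * (- 2 * \<theta> * (norm x)^2)"
      using D0 nn by (intro mult_left_mono) auto
    moreover have "k * (E \<bullet> outer x) \<le> k * (\<theta> * (norm x)^2)"
    proof (rule mult_left_mono[OF _ nn(1)])
      have "E \<bullet> outer x \<le> norm E * norm (outer x)" by (rule norm_cauchy_schwarz)
      also have "\<dots> \<le> \<theta> * (norm x)^2" unfolding norm_outer using E by (intro mult_right_mono) auto
      finally show "E \<bullet> outer x \<le> \<theta> * (norm x)^2" .
    qed
    moreover have "- (\<beta> * (dT_mat T q' \<bullet> mat 1)) \<le> \<beta> * ((norm D0 + \<theta>) * norm (mat 1 :: real^'n^'n))"
    proof -
      have "norm (dT_mat T q') \<le> norm D0 + \<theta>"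
        using E norm_triangle_ineq[of D0 E] by (simp add: E_def)
      then have "- (dT_mat T q' \<bullet> mat 1) \<le> (norm D0 + \<theta>) * norm (mat 1 :: real^'n^'n)"
        using Cauchy_Schwarz_ineq2[of "dT_mat T q'" "mat 1"]
          mult_right_mono[of "norm (dT_mat T q')" "norm D0 + \<theta>" "norm (mat 1 :: real^'n^'n)"] by simp
      from mult_left_mono[OF this nn(2)] show ?thesis by simp
    qed
    ultimately have 1: "F q' (s, p, ?H) \<le> (norm (F q0) + 1) * (\<bar>s\<bar> + norm p) +
       \<beta> * ((norm D0 + \<theta>) * norm (mat 1 :: real^'n^'n)) - k * \<theta> * (norm x)^2"
      by linarith
    have "(norm (F q0) + 1) * (\<bar>s\<bar> + norm p) \<le> C * (\<bar>s\<bar> + norm p)"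
      using \<theta> by (intro mult_right_mono) (auto simp: C_def)
    moreover have "\<beta> * ((norm D0 + \<theta>) * norm (mat 1 :: real^'n^'n)) \<le> \<beta> * C"
      using nn by (intro mult_left_mono) (auto simp: C_def)
    ultimately show "T (q + (s, p, ?H)) \<le> T q + C * (\<bar>s\<bar> + norm p + \<beta>) - k * \<theta> * (norm x)^2"
      using 1 t(4) unfolding q'_def[symmetric] by (simp add: algebra_simps)
  qed (use \<eta>1 \<eta>2 \<theta> C in auto)
qed

lemma C1_on_continuous_on:
  assumes "C1_on S T" shows "continuous_on S T"
proof -
  obtain F where F: "\<forall>p\<in>S. (T has_derivative blinfun_apply (F p)) (at p within S)"
    using assms unfolding C1_on_def by blast
  show ?thesis
    by (rule has_derivative_continuous_on[of S T "\<lambda>p. blinfun_apply (F p)"]) (use F in blast)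
qed

text \<open>Every jet with positive value and symmetric Hessian belongs to a positive \<open>C\<^sup>2\<close> function on the whole
  space, namely the exponential of a quadratic polynomial. Hence invariance under scaling, assumed for
  global functions, is a homogeneity property of the operator itself and applies to functions defined
  on a ball only.\<close>

lemma scaling_invariant_jet:
  fixes p :: "real^'n"
  assumes inv: "scaling_invariant T" and s: "s > 0" and M: "transpose M = M" and \<mu>: "\<mu> > 0"
    and a: "a = (real CARD('n) - 2) / 2"
  shows "T (\<mu> powr a * s, (\<mu> powr a * \<mu>) *\<^sub>R p, (\<mu> powr a * \<mu>^2) *\<^sub>R M) = T (s, p, M)"
proof -
  define b where "b = (1 / s) *\<^sub>R p"
  define N where "N = (1 / s) *\<^sub>R M + (- 1) *\<^sub>R outer b"
  define q where "q y = ln s + b \<bullet> (y - 0) + (1/2) * ((y - 0) \<bullet> (N *v (y - 0)))" for y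
  define w where "w y = exp (q y)" for y
  have N: "transpose N = N" unfolding N_def transpose_add transpose_scaleR transpose_outer M ..
  have q: "has_2jet q y (b + N *v (y - 0)) N" for y
    unfolding q_def by (rule has_2jet_quadratic[OF N])
  have w: "has_2jet w y (exp (q y) *\<^sub>R (b + N *v (y - 0))) (exp (q y) *\<^sub>R N + exp (q y) *\<^sub>R outer (b + N *v (y - 0)))" for y
    unfolding w_def by (rule has_2jet_compose[OF q open_UNIV]) (auto intro: DERIV_exp)
  have contN: "continuous_on UNIV (\<lambda>y. N *v (y - 0))"
    by (simp add: linear_continuous_on)
  have contq: "continuous_on UNIV q"
    using has_2jet_continuous[OF q] by (simp add: continuous_on_eq_continuous_at)
  have "C2_on UNIV w"
    by (rule C2_onI[OF w]) (unfold outer_def, intro continuous_intros contN contq continuous_on_vec_lambda)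
  moreover have "w y > 0" for y by (simp add: w_def)
  ultimately have T: "T (jet (rescale \<mu> w) 0) = T (jet w (\<mu> *\<^sub>R 0))"
    using inv \<mu> unfolding scaling_invariant_def by blast
  have q0: "exp (q 0) = s" using s by (simp add: q_def)
  have "s *\<^sub>R N + s *\<^sub>R outer b = M" "s *\<^sub>R b = p"
    using s unfolding N_def scaleR_right_distrib by (simp_all add: b_def scaleR_right_diff_distrib)
  then have w0: "has_2jet w 0 p M"
    using w[of 0] unfolding q0 by simp
  have "has_2jet (\<lambda>y. \<mu> powr a * w (\<mu> *\<^sub>R y + 0)) 0 ((\<mu> powr a * \<mu>) *\<^sub>R p) ((\<mu> powr a * \<mu>^2) *\<^sub>R M)"
    by (rule has_2jet_rescale) (use w0 in simp)
  then have "has_2jet (rescale \<mu> w) 0 ((\<mu> powr a * \<mu>) *\<^sub>R p) ((\<mu> powr a * \<mu>^2) *\<^sub>R M)"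
    by (simp add: rescale_def[abs_def] a)
  from has_2jetD[OF this] have "jet (rescale \<mu> w) 0 = (\<mu> powr a * s, (\<mu> powr a * \<mu>) *\<^sub>R p, (\<mu> powr a * \<mu>^2) *\<^sub>R M)"
    using q0 by (simp add: jet_def rescale_def w_def a)
  moreover have "jet w 0 = (s, p, M)"
    using has_2jetD[OF w0] q0 by (simp add: jet_def w_def)
  ultimately show ?thesis using T by simp
qed

section \<open>The strong maximum principle\<close>

lemma transpose_mat_1_scaled: "transpose (c *\<^sub>R (mat 1 :: real^'n^'n)) = c *\<^sub>R mat 1"
  by (simp add: transpose_scaleR)

lemma has_2jet_gaussian:
  fixes y :: "real^'n"
  shows "has_2jet (\<lambda>x. exp (- \<alpha> * (norm (x - y))^2)) x
     ((- 2 * \<alpha> * exp (- \<alpha> * (norm (x - y))^2)) *\<^sub>R (x - y))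
     ((4 * \<alpha>^2 * exp (- \<alpha> * (norm (x - y))^2)) *\<^sub>R outer (x - y)
        - (2 * \<alpha> * exp (- \<alpha> * (norm (x - y))^2)) *\<^sub>R mat 1)"
proof -
  define N :: "real^'n^'n" where "N = (- 2 * \<alpha>) *\<^sub>R mat 1"
  define q where "q x = 0 + 0 \<bullet> (x - y) + (1/2) * ((x - y) \<bullet> (N *v (x - y)))" for x
  have Nv: "N *v x = (- 2 * \<alpha>) *\<^sub>R x" for x
    unfolding N_def scaleR_matrix_vector_assoc[symmetric] by simp
  have q_eq: "q x = - \<alpha> * (norm (x - y))^2" for x
    unfolding q_def Nv by (simp add: power2_norm_eq_inner)
  have q: "has_2jet q x (0 + N *v (x - y)) N" for x
    unfolding q_def by (rule has_2jet_quadratic) (simp only: N_def transpose_mat_1_scaled)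
  have outer: "outer (0 + N *v (x - y)) = (4 * \<alpha>^2) *\<^sub>R outer (x - y)"
    unfolding Nv by (simp add: outer_def vec_eq_iff power2_eq_square)
  have "has_2jet (\<lambda>x. exp (q x)) x (exp (q x) *\<^sub>R (0 + N *v (x - y)))
      (exp (q x) *\<^sub>R N + exp (q x) *\<^sub>R outer (0 + N *v (x - y)))"
    by (rule has_2jet_compose[OF q open_UNIV]) (auto intro: DERIV_exp)
  from this[unfolded outer, unfolded Nv q_eq, unfolded N_def] show ?thesis
    by (simp add: mult_ac)
qed

text \<open>The argument of Hopf. Let \<open>\<psi>\<close> be the Gaussian centred at \<open>y\<close> minus its value on the sphere, so that
  \<open>\<psi>\<close> is positive exactly inside. For small \<open>\<epsilon>\<close> the function \<open>u - w - \<epsilon> \<psi>\<close> is positive on a small sphere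
  around \<open>z\<close> and vanishes at \<open>z\<close>, hence has an interior minimum \<open>x1\<close>. There the jet of \<open>u\<close> is that of
  \<open>w\<close>, plus a value between \<open>0\<close> and \<open>\<epsilon> \<psi>\<close>, plus the derivatives of \<open>\<epsilon> \<psi>\<close>, plus a positive semidefinite
  Hessian. Ellipticity and the steepness of \<open>\<psi>\<close> then force the operator to be negative at \<open>u\<close>.\<close>

lemma hopf_touching:
  fixes T :: "real \<times> (real^'n) \<times> (real^'n^'n) \<Rightarrow> real"
  assumes C1: "C1_on jet_domain T" and ell: "elliptic T"
    and \<Omega>: "open \<Omega>" and u: "C2_on \<Omega> u" and w: "C2_on \<Omega> w"
    and pos: "\<And>x. x \<in> \<Omega> \<Longrightarrow> 0 < w x" and le: "\<And>x. x \<in> \<Omega> \<Longrightarrow> w x \<le> u x"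
    and Tu: "\<And>x. x \<in> \<Omega> \<Longrightarrow> T (jet u x) \<ge> 0" and Tw: "\<And>x. x \<in> \<Omega> \<Longrightarrow> T (jet w x) \<le> 0"
    and R: "R > 0" "cball y R \<subseteq> \<Omega>" and z: "dist y z = R" "u z = w z"
    and less: "\<And>x. x \<in> cball y R \<Longrightarrow> x \<noteq> z \<Longrightarrow> w x < u x"
  shows False
proof -
  have z\<Omega>: "z \<in> \<Omega>" using R z by auto
  have ju: "has_2jet u x (grad u x) (hess u x)" and jw: "has_2jet w x (grad w x) (hess w x)" if "x \<in> \<Omega>" for x
    using C2_on_has_2jet u w \<Omega> that by blast+
  have jet_in: "jet w x \<in> jet_domain" if "x \<in> \<Omega>" for x
    using pos[OF that] has_2jet_symmetric[OF jw[OF that]] by (simp add: jet_def jet_domain_def sym_mats_def)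
  obtain \<eta> \<theta> C where const: "\<eta> > 0" "\<theta> > 0" "C > 0"
    and est: "\<And>q s p x k \<beta>. \<lbrakk>q \<in> jet_domain; q + (s, p, k *\<^sub>R outer x - \<beta> *\<^sub>R mat 1) \<in> jet_domain;
       dist q (jet w z) < \<eta>; dist (q + (s, p, k *\<^sub>R outer x - \<beta> *\<^sub>R mat 1)) (jet w z) < \<eta>; k \<ge> 0; \<beta> \<ge> 0\<rbrakk> \<Longrightarrow>
       T (q + (s, p, k *\<^sub>R outer x - \<beta> *\<^sub>R mat 1)) \<le> T q + C * (\<bar>s\<bar> + norm p + \<beta>) - k * \<theta> * (norm x)^2"
    using elliptic_local_estimate[OF C1 ell jet_in[OF z\<Omega>]] by metis
  have "continuous_on \<Omega> (jet w)"
    unfolding jet_def using C2_on_continuous[OF w \<Omega>] w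
    by (intro continuous_intros) (auto simp: C2_on_def)
  then obtain \<rho>0 where \<rho>0: "\<rho>0 > 0" "\<And>x. x \<in> \<Omega> \<Longrightarrow> dist x z < \<rho>0 \<Longrightarrow> dist (jet w x) (jet w z) < \<eta> / 2"
    using z\<Omega> const unfolding continuous_on_iff by (metis half_gt_zero)
  obtain \<rho>1 where \<rho>1: "\<rho>1 > 0" "cball z \<rho>1 \<subseteq> \<Omega>" using \<Omega> z\<Omega> open_contains_cball by blast
  define \<rho> where "\<rho> = Min {\<rho>0 / 2, \<rho>1, R / 2}"
  have \<rho>: "\<rho> > 0" "\<rho> < \<rho>0" "\<rho> \<le> \<rho>1" "\<rho> \<le> R / 2"
    using \<rho>0 \<rho>1 R by (auto simp: \<rho>_def min_def)
  have sub: "cball z \<rho> \<subseteq> \<Omega>" using \<rho> \<rho>1 by (meson order_trans subset_cball)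
  \<comment> \<open>Large enough for the quadratic term in \<open>\<alpha>\<close> of the Hessian of the barrier to win over the
      terms linear in \<open>\<alpha>\<close>.\<close>
  define \<alpha> where "\<alpha> = 1 + C * (3 + 4 * R) / (\<theta> * R^2)"
  have \<alpha>1: "\<alpha> \<ge> 1" using const R by (simp add: \<alpha>_def)
  have \<alpha>: "C * (1 + 4 * \<alpha> * R + 2 * \<alpha>) < \<alpha>^2 * \<theta> * R^2"
  proof -
    have "C * (1 + 4 * \<alpha> * R + 2 * \<alpha>) \<le> C * (\<alpha> * (3 + 4 * R))"
      using \<alpha>1 const R by (intro mult_left_mono) (auto simp: algebra_simps)
    also have "\<dots> < \<alpha> * (\<alpha> * (\<theta> * R^2))"
    proof -
      have "C * (3 + 4 * R) < \<alpha> * (\<theta> * R^2)"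
        using const R by (simp add: \<alpha>_def field_simps)
      then show ?thesis using \<alpha>1 by (simp add: mult.left_commute)
    qed
    finally show ?thesis by (simp add: power2_eq_square mult_ac)
  qed
  define E where "E x = exp (- \<alpha> * (norm (x - y))^2)" for x
  define \<psi> where "\<psi> x = E x - exp (- \<alpha> * R^2)" for x
  have E: "0 < E x" "E x \<le> 1" for x using \<alpha>1 by (auto simp: E_def)
  have \<psi>1: "\<psi> x \<le> E x" for x by (simp add: \<psi>_def)
  have \<psi>z: "\<psi> z = 0" using z by (simp add: \<psi>_def E_def dist_norm norm_minus_commute)
  have \<psi>neg: "\<psi> x < 0" if "x \<notin> cball y R" for x
  proof -
    have "R^2 < (norm (x - y))^2"
      using that R by (intro power_strict_mono) (auto simp: dist_norm norm_minus_commute)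
    then show ?thesis using \<alpha>1 by (simp add: \<psi>_def E_def)
  qed
  have contuw: "continuous_on \<Omega> (\<lambda>x. u x - w x)"
    using C2_on_continuous[OF u \<Omega>] C2_on_continuous[OF w \<Omega>] by (intro continuous_intros)
  obtain \<delta> where \<delta>: "\<delta> > 0" "\<And>x. x \<in> sphere z \<rho> \<inter> cball y R \<Longrightarrow> \<delta> \<le> u x - w x"
  proof (cases "sphere z \<rho> \<inter> cball y R = {}")
    case True
    then show ?thesis using that[of 1] by auto
  next
    case False
    have "continuous_on (sphere z \<rho> \<inter> cball y R) (\<lambda>x. u x - w x)"
      using R by (intro continuous_on_subset[OF contuw]) auto
    then obtain x0 where "x0 \<in> sphere z \<rho> \<inter> cball y R" "\<forall>x\<in>sphere z \<rho> \<inter> cball y R. u x0 - w x0 \<le> u x - w x"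
      using continuous_attains_inf[OF compact_Int_closed[OF compact_sphere closed_cball] False] by blast
    moreover from this have "x0 \<noteq> z" using \<rho> by auto
    ultimately show ?thesis using that[of "u x0 - w x0"] less[of x0] by auto
  qed
  define K where "K = 1 + 4 * \<alpha> * R + 16 * \<alpha>^2 * R^2 + 2 * \<alpha> * norm (mat 1 :: real^'n^'n)"
  have K: "K > 0" unfolding K_def using \<alpha>1 R by (intro add_pos_nonneg) auto
  define \<epsilon> where "\<epsilon> = min (\<delta> / 2) (\<eta> / (4 * K))"
  have \<epsilon>: "\<epsilon> > 0" "\<epsilon> < \<delta>" "\<epsilon> * K < \<eta> / 2"
  proof -
    show "\<epsilon> > 0" "\<epsilon> < \<delta>" using \<delta> const K by (auto simp: \<epsilon>_def min_def)
    have "\<epsilon> * K \<le> \<eta> / (4 * K) * K" using K by (intro mult_right_mono) (auto simp: \<epsilon>_def)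
    also have "\<dots> < \<eta> / 2" using K const by simp
    finally show "\<epsilon> * K < \<eta> / 2" .
  qed
  define g where "g x = u x - w x - \<epsilon> * \<psi> x" for x
  have "continuous_on (cball z \<rho>) g"
    unfolding g_def \<psi>_def E_def by (intro continuous_intros continuous_on_subset[OF contuw sub])
  then obtain x1 where x1: "x1 \<in> cball z \<rho>" "\<And>x. x \<in> cball z \<rho> \<Longrightarrow> g x1 \<le> g x"
    using continuous_attains_inf[of "cball z \<rho>" g] \<rho> by auto
  have g1: "g x1 \<le> 0" using x1(2)[of z] \<rho> z \<psi>z by (simp add: g_def)
  have "x1 \<notin> sphere z \<rho>"
  proof
    assume s: "x1 \<in> sphere z \<rho>"
    show False
    proof (cases "x1 \<in> cball y R")
      case True
      have "\<epsilon> * \<psi> x1 \<le> \<epsilon> * 1" using \<epsilon> \<psi>1[of x1] E(2)[of x1] by (intro mult_left_mono) auto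
      moreover have "\<delta> \<le> u x1 - w x1" using \<delta>(2) s True by blast
      ultimately show False using g1 \<epsilon> unfolding g_def by linarith
    next
      case False
      then have "\<epsilon> * \<psi> x1 < 0" using \<psi>neg \<epsilon> by (simp add: mult_pos_neg)
      then show False using g1 le[of x1] sub x1 by (auto simp: g_def)
    qed
  qed
  then have x1b: "x1 \<in> ball z \<rho>" using x1 by auto
  have x1\<Omega>: "x1 \<in> \<Omega>" using x1 sub by auto
  define d where "d = x1 - y"
  define e where "e = E x1"
  have e: "0 < e" "e \<le> 1" using E by (auto simp: e_def)
  have d: "R / 2 \<le> norm d" "norm d \<le> 2 * R"
  proof -
    have "dist z x1 < R / 2" "dist y z = R" using x1b \<rho> z by auto
    then show "R / 2 \<le> norm d" "norm d \<le> 2 * R"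
      using dist_triangle[of y z x1] dist_triangle[of y x1 z] R
      by (auto simp: d_def dist_norm norm_minus_commute)
  qed
  define k \<beta> where "k = \<epsilon> * (4 * \<alpha>^2 * e)" and "\<beta> = \<epsilon> * (2 * \<alpha> * e)"
  have k\<beta>: "k \<ge> 0" "\<beta> \<ge> 0" using \<epsilon> e \<alpha>1 by (auto simp: k_def \<beta>_def)
  define H where "H = k *\<^sub>R outer d - \<beta> *\<^sub>R (mat 1 :: real^'n^'n)"
  define s p where "s = u x1 - w x1" and "p = (- \<beta>) *\<^sub>R d"
  define P where "P = hess u x1 - hess w x1 - H"
  have "has_2jet (\<lambda>x. E x - exp (- \<alpha> * R^2)) x1 ((- 2 * \<alpha> * e) *\<^sub>R d) ((4 * \<alpha>^2 * e) *\<^sub>R outer d - (2 * \<alpha> * e) *\<^sub>R mat 1)"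
  proof -
    have "has_2jet (\<lambda>x. - exp (- \<alpha> * R^2)) x1 0 (0 :: real^'n^'n)"
      using has_2jet_quadratic[of "0 :: real^'n^'n" "- exp (- \<alpha> * R^2)" 0 0 x1] by (simp add: transpose_def vec_eq_iff)
    from has_2jet_add[OF has_2jet_gaussian[of \<alpha> y x1] this] show ?thesis by (simp add: E_def e_def d_def)
  qed
  from has_2jet_diff[OF has_2jet_diff[OF ju jw] has_2jet_cmult[OF this, of \<epsilon>], OF x1\<Omega> x1\<Omega>]
  have jg: "has_2jet g x1 (grad u x1 - grad w x1 - p) P"
    by (simp add: g_def[abs_def] \<psi>_def P_def H_def p_def k_def \<beta>_def scaleR_right_diff_distrib mult_ac)
  have min: "g x1 \<le> g x" if "x \<in> ball z \<rho>" for x using x1(2) that by auto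
  have p: "grad u x1 = grad w x1 + p"
    using has_2jet_local_min(1)[OF jg open_ball x1b min] by (simp add: algebra_simps)
  have P: "\<xi> \<bullet> (P *v \<xi>) \<ge> 0" for \<xi>
    using has_2jet_local_min(2)[OF jg open_ball x1b min] by simp
  have inc: "jet w x1 + (s, p, H) = (u x1, grad w x1 + p, hess w x1 + H)"
    by (simp add: jet_def s_def)
  have symH: "H \<in> sym_mats"
    unfolding H_def by (intro subspace_diff[OF sym_mats_subspace] subspace_scale[OF sym_mats_subspace] mat_1_in_sym_mats)
      (simp add: sym_mats_def transpose_outer)
  have in2: "jet w x1 + (s, p, H) \<in> jet_domain"
    using jet_in[OF x1\<Omega>] pos[OF x1\<Omega>] le[OF x1\<Omega>] subspace_add[OF sym_mats_subspace _ symH, of "hess w x1"]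
    unfolding inc by (simp add: jet_domain_def jet_def)
  have ju1: "jet u x1 = (u x1, grad w x1 + p, (hess w x1 + H) + P)"
    by (simp add: jet_def p P_def)
  have s: "0 \<le> s" "s \<le> \<epsilon> * e"
  proof -
    show "0 \<le> s" using le[OF x1\<Omega>] by (simp add: s_def)
    have "s \<le> \<epsilon> * \<psi> x1" using g1 by (simp add: g_def s_def)
    also have "\<dots> \<le> \<epsilon> * e" using \<psi>1 \<epsilon> by (simp add: e_def)
    finally show "s \<le> \<epsilon> * e" .
  qed
  have np: "norm p = \<beta> * norm d" using k\<beta> by (simp add: p_def)
  have "norm (s, p, H) \<le> \<epsilon> * K"
  proof -
    have "norm (s, p, H) \<le> \<bar>s\<bar> + (norm p + norm H)"
      using norm_Pair_le[of s "(p, H)"] norm_Pair_le[of p H] by simp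
    also have "\<bar>s\<bar> \<le> \<epsilon> * 1"
      using s \<epsilon> e mult_left_mono[of e 1 \<epsilon>] by linarith
    also have "norm p \<le> \<epsilon> * (4 * \<alpha> * R)"
    proof -
      have "norm p = \<epsilon> * (2 * \<alpha> * (e * norm d))" by (simp add: np \<beta>_def)
      also have "\<dots> \<le> \<epsilon> * (2 * \<alpha> * (1 * (2 * R)))"
        using e d \<epsilon> \<alpha>1 by (intro mult_left_mono mult_mono) auto
      finally show ?thesis by simp
    qed
    also have "norm H \<le> k * norm (outer d) + \<beta> * norm (mat 1 :: real^'n^'n)"
      unfolding H_def using norm_triangle_ineq4[of "k *\<^sub>R outer d" "\<beta> *\<^sub>R (mat 1 :: real^'n^'n)"] k\<beta> by simp
    also have "k * norm (outer d) \<le> \<epsilon> * (16 * \<alpha>^2 * R^2)"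
    proof -
      have "k * norm (outer d) = \<epsilon> * (4 * \<alpha>^2 * (e * (norm d)^2))" by (simp add: k_def norm_outer)
      also have "\<dots> \<le> \<epsilon> * (4 * \<alpha>^2 * (1 * (2 * R)^2))"
        using e d \<epsilon> by (intro mult_left_mono mult_mono power_mono) auto
      finally show ?thesis by (simp add: power_mult_distrib)
    qed
    also have "\<beta> * norm (mat 1 :: real^'n^'n) \<le> \<epsilon> * (2 * \<alpha> * norm (mat 1 :: real^'n^'n))"
      unfolding \<beta>_def using e \<epsilon> \<alpha>1 by (simp add: mult.assoc mult_left_le_one_le)
    finally show ?thesis by (simp add: K_def algebra_simps)
  qed
  then have near: "dist (jet w x1 + (s, p, H)) (jet w z) < \<eta>" "dist (jet w x1) (jet w z) < \<eta>"
  proof -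
    assume n: "norm (s, p, H) \<le> \<epsilon> * K"
    have 1: "dist (jet w x1) (jet w z) < \<eta> / 2"
      using \<rho>0(2)[OF x1\<Omega>] x1b \<rho> by (simp add: dist_commute)
    then show "dist (jet w x1) (jet w z) < \<eta>" using const by simp
    have "dist (jet w x1 + (s, p, H)) (jet w x1) < \<eta> / 2"
      using n \<epsilon> by (simp add: dist_norm)
    then show "dist (jet w x1 + (s, p, H)) (jet w z) < \<eta>"
      using 1 dist_triangle[of "jet w x1 + (s, p, H)" "jet w z" "jet w x1"] by simp
  qed
  have "0 \<le> T (jet u x1)" using Tu x1\<Omega> by blast
  also have "\<dots> \<le> T (jet w x1 + (s, p, H))"
    unfolding inc ju1
  proof (rule elliptic_decreasing[OF C1 ell])
    show "(u x1, grad w x1 + p, hess w x1 + H) \<in> jet_domain" using in2 unfolding inc .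
    show "transpose P = P" by (rule has_2jet_symmetric[OF jg])
  qed (rule P)
  also have "\<dots> \<le> T (jet w x1) + C * (\<bar>s\<bar> + norm p + \<beta>) - k * \<theta> * (norm d)^2"
    unfolding H_def
    by (rule est) (use near in2 jet_in[OF x1\<Omega>] k\<beta> in \<open>simp_all add: H_def\<close>)
  also have "\<dots> \<le> 0 + C * (\<epsilon> * e * (1 + 4 * \<alpha> * R + 2 * \<alpha>)) - \<epsilon> * e * (\<alpha>^2 * \<theta> * R^2)"
  proof (intro add_mono diff_mono mult_left_mono)
    have "norm p \<le> \<beta> * (2 * R)" unfolding np using d k\<beta> by (intro mult_left_mono)
    then show "\<bar>s\<bar> + norm p + \<beta> \<le> \<epsilon> * e * (1 + 4 * \<alpha> * R + 2 * \<alpha>)"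
      using s by (simp add: \<beta>_def algebra_simps)
    have "(R / 2)^2 \<le> (norm d)^2" using d R by (intro power_mono) auto
    then have "(k * \<theta>) * (R / 2)^2 \<le> (k * \<theta>) * (norm d)^2"
      using k\<beta> const by (intro mult_left_mono) auto
    then show "\<epsilon> * e * (\<alpha>^2 * \<theta> * R^2) \<le> k * \<theta> * (norm d)^2"
      by (simp add: k_def power_divide mult_ac)
  qed (use Tw[OF x1\<Omega>] const in auto)
  also have "\<dots> = \<epsilon> * e * (C * (1 + 4 * \<alpha> * R + 2 * \<alpha>) - \<alpha>^2 * \<theta> * R^2)"
    by (simp add: algebra_simps)
  also have "\<dots> < 0" using \<alpha> \<epsilon> e by (simp add: mult_pos_neg)
  finally show False by simp
qed

text \<open>The contact set is closed, and it is open: a point \<open>x0\<close> off the contact set but close to it would have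
  a nearest contact point \<open>z1\<close>. The ball around \<open>x0\<close> through \<open>z1\<close> may meet the contact set in further
  boundary points, but the ball with diameter from \<open>x0\<close> to \<open>z1\<close> meets it in \<open>z1\<close> alone, which
  the argument of Hopf excludes.\<close>

lemma strong_maximum_principle:
  fixes T :: "real \<times> (real^'n) \<times> (real^'n^'n) \<Rightarrow> real"
  assumes C1: "C1_on jet_domain T" and ell: "elliptic T"
    and \<Omega>: "open \<Omega>" "connected \<Omega>" and u: "C2_on \<Omega> u" and w: "C2_on \<Omega> w"
    and pos: "\<And>x. x \<in> \<Omega> \<Longrightarrow> 0 < w x" and le: "\<And>x. x \<in> \<Omega> \<Longrightarrow> w x \<le> u x"
    and Tu: "\<And>x. x \<in> \<Omega> \<Longrightarrow> T (jet u x) \<ge> 0" and Tw: "\<And>x. x \<in> \<Omega> \<Longrightarrow> T (jet w x) \<le> 0"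
    and y0: "y0 \<in> \<Omega>" "u y0 = w y0" and x: "x \<in> \<Omega>"
  shows "u x = w x"
proof -
  define Z where "Z = {x \<in> \<Omega>. u x - w x = 0}"
  have cont: "continuous_on \<Omega> (\<lambda>x. u x - w x)"
    using C2_on_continuous[OF u \<Omega>(1)] C2_on_continuous[OF w \<Omega>(1)] by (intro continuous_intros)
  have cl: "closedin (top_of_set \<Omega>) Z"
    unfolding Z_def by (rule continuous_closedin_preimage_constant[OF cont])
  have "open Z"
    unfolding open_contains_ball
  proof
    fix z0 assume z0: "z0 \<in> Z"
    then have "z0 \<in> \<Omega>" by (simp add: Z_def)
    then obtain e where e: "e > 0" "cball z0 (2 * e) \<subseteq> \<Omega>"
      using \<Omega>(1) open_contains_cball by (metis field_sum_of_halves half_gt_zero mult_2)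
    have "x0 \<in> Z" if x0: "x0 \<in> ball z0 e" for x0
    proof (rule ccontr)
      assume "x0 \<notin> Z"
      have comp: "compact (cball z0 (2 * e) \<inter> Z)"
      proof -
        obtain F where "closed F" "Z = \<Omega> \<inter> F" using cl unfolding closedin_closed by blast
        then have "cball z0 (2 * e) \<inter> Z = cball z0 (2 * e) \<inter> F" using e by blast
        then show ?thesis using \<open>closed F\<close> by (simp add: compact_Int_closed)
      qed
      have "z0 \<in> cball z0 (2 * e) \<inter> Z" using z0 e by simp
      then obtain z1 where z1: "z1 \<in> cball z0 (2 * e)" "z1 \<in> Z"
        "\<And>z. z \<in> cball z0 (2 * e) \<Longrightarrow> z \<in> Z \<Longrightarrow> dist x0 z1 \<le> dist x0 z"
        using continuous_attains_inf[OF comp _ continuous_on_dist[OF continuous_on_const continuous_on_id], of x0]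
        by (metis IntD1 IntD2 IntI empty_iff)
      define R where "R = dist x0 z1"
      have R: "R > 0" using z1 \<open>x0 \<notin> Z\<close> by (auto simp: R_def)
      have Re: "R < e" using z1(3)[of z0] z0 x0 e by (simp add: R_def dist_commute)
      define y where "y = midpoint x0 z1"
      have y: "dist y z1 = R / 2" "dist x0 y = R / 2"
        by (simp_all add: y_def R_def dist_midpoint)
      have in_ball: "x \<in> ball x0 R" if "x \<in> cball y (R / 2)" "x \<noteq> z1" for x
      proof (rule ccontr)
        assume "x \<notin> ball x0 R"
        define a b where "a = x - y" and "b = y - x0"
        have b: "norm b = R / 2" using y by (simp add: b_def dist_norm norm_minus_commute)
        have a: "norm a \<le> R / 2" using that by (simp add: a_def dist_norm norm_minus_commute)
        have ab: "norm (a + b) \<ge> R"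
          using \<open>x \<notin> ball x0 R\<close> by (simp add: a_def b_def dist_norm norm_minus_commute)
        have "(norm (a - b))^2 = 2 * (norm a)^2 + 2 * (norm b)^2 - (norm (a + b))^2"
          by (simp add: power2_norm_eq_inner inner_add_left inner_add_right inner_diff_left inner_diff_right inner_commute)
        also have "\<dots> \<le> 2 * (R / 2)^2 + 2 * (R / 2)^2 - R^2"
          using a b ab R by (intro diff_mono add_mono mult_left_mono power_mono) auto
        also have "\<dots> = 0" by (simp add: power_divide)
        finally have "a = b" by simp
        then have "x = 2 *\<^sub>R y - x0" by (simp add: a_def b_def algebra_simps scaleR_2)
        then have "x = z1" by (simp add: y_def midpoint_def scaleR_2)
        with that show False by simp
      qed
      have ball_sub: "ball x0 R \<subseteq> cball z0 (2 * e)"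
      proof
        fix x assume "x \<in> ball x0 R"
        then show "x \<in> cball z0 (2 * e)"
          using x0 Re dist_triangle[of z0 x x0] by simp
      qed
      show False
      proof (rule hopf_touching[OF C1 ell \<Omega>(1) u w pos le Tu Tw, where R="R/2" and y=y and z=z1])
        show "cball y (R / 2) \<subseteq> \<Omega>"
          using in_ball ball_sub e z1 by blast
        show "u z1 = w z1" using z1 by (simp add: Z_def)
        show "w x < u x" if "x \<in> cball y (R / 2)" "x \<noteq> z1" for x
        proof -
          have x: "x \<in> ball x0 R" by (rule in_ball[OF that])
          then have "x \<notin> Z" using z1(3)[of x] ball_sub by (auto simp: R_def)
          moreover have "x \<in> \<Omega>" using x ball_sub e by blast
          ultimately show ?thesis using le[of x] by (simp add: Z_def)
        qed
      qed (use R y in auto)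
    qed
    then show "\<exists>e>0. ball z0 e \<subseteq> Z" using e by blast
  qed
  then have op: "openin (top_of_set \<Omega>) Z" by (simp add: Z_def open_subset)
  have "Z = {} \<or> Z = \<Omega>" using \<Omega>(2) cl op unfolding connected_clopen by blast
  then show ?thesis using x y0 by (auto simp: Z_def)
qed

section \<open>Superharmonic functions near an isolated singularity\<close>

lemma trace_psd_nonneg:
  fixes P :: "real^'n^'n"
  assumes "\<And>x. x \<bullet> (P *v x) \<ge> 0"
  shows "trace P \<ge> 0"
proof -
  have "P$i$i \<ge> 0" for i
    using assms[of "axis i 1"] by (simp add: inner_axis' matrix_vector_mul_component inner_axis)
  then show ?thesis by (simp add: trace_def sum_nonneg)
qed

lemma trace_mat_1: "trace (mat 1 :: real^'n^'n) = CARD('n)"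
  by (simp add: trace_def mat_def)

lemma trace_scaleR: "trace (c *\<^sub>R A) = c * trace (A :: real^'n^'n)"
  by (simp add: trace_def sum_distrib_left)

lemma trace_outer: "trace (outer x) = (norm x)^2"
  by (simp add: trace_def outer_def power2_norm_eq_inner inner_vec_def)

text \<open>The function \<open>\<bar>x\<bar> powr (- 1/2)\<close>; any exponent strictly between \<open>2 - n\<close> and \<open>0\<close> makes the Laplacian
  negative.\<close>

lemma singular_barrier:
  fixes x :: "real^'n"
  assumes n: "CARD('n) \<ge> 3" and x: "x \<noteq> 0"
  obtains p M where "has_2jet (\<lambda>y. ((norm y)^2) powr (- 1/4)) x p M" "trace M < 0"
proof -
  define N :: "real^'n^'n" where "N = 2 *\<^sub>R mat 1"
  define q where "q x = 0 + 0 \<bullet> (x - 0) + (1/2) * ((x - 0) \<bullet> (N *v (x - 0)))" for x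
  have Nv: "N *v x = 2 *\<^sub>R x" for x
    unfolding N_def scaleR_matrix_vector_assoc[symmetric] by simp
  have q_eq: "q x = (norm x)^2" for x
    unfolding q_def Nv by (simp add: power2_norm_eq_inner)
  have q: "has_2jet q x (0 + N *v (x - 0)) N"
    unfolding q_def by (rule has_2jet_quadratic) (simp only: N_def transpose_mat_1_scaled)
  let ?s = "(norm x)^2"
  have s: "?s > 0" using x by simp
  let ?M = "(- 1/4 * ?s powr (- 5/4)) *\<^sub>R N + (5/16 * ?s powr (- 9/4)) *\<^sub>R outer (0 + N *v (x - 0))"
  have "has_2jet (\<lambda>y. (q y) powr (- 1/4)) x ((- 1/4 * q x powr (- 5/4)) *\<^sub>R (0 + N *v (x - 0)))
     ((- 1/4 * q x powr (- 5/4)) *\<^sub>R N + (5/16 * ?s powr (- 9/4)) *\<^sub>R outer (0 + N *v (x - 0)))"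
  proof (rule has_2jet_compose[OF q open_greaterThan[of 0], where \<phi>' = "\<lambda>s. - 1/4 * s powr (- 5/4)"])
    show "q x \<in> {0<..}" using s by (simp add: q_eq)
    show "((\<lambda>s. s powr (- 1/4)) has_real_derivative (- 1/4 * s powr (- 5/4))) (at s)" if "s \<in> {0<..}" for s :: real
      using that by (auto intro!: derivative_eq_intros)
    show "((\<lambda>s. - 1/4 * s powr (- 5/4)) has_real_derivative (5/16 * ?s powr (- 9/4))) (at (q x))"
      using s unfolding q_eq by (auto intro!: derivative_eq_intros)
  qed
  then have "has_2jet (\<lambda>y. ((norm y)^2) powr (- 1/4)) x ((- 1/4 * ?s powr (- 5/4)) *\<^sub>R (0 + N *v (x - 0))) ?M"
    unfolding q_eq .
  moreover have "trace ?M < 0"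
  proof -
    have o: "outer (0 + N *v (x - 0)) = 4 *\<^sub>R outer x"
      unfolding Nv by (simp add: outer_def vec_eq_iff)
    have "?s powr (- 9/4) * ?s = ?s powr (- 9/4) * ?s powr 1" using s by simp
    also have "\<dots> = ?s powr (- 5/4)" unfolding powr_add[symmetric] by simp
    finally have 1: "?s powr (- 9/4) * ?s = ?s powr (- 5/4)" .
    have "trace ?M = - (1/2) * ?s powr (- 5/4) * CARD('n) + (5/4) * (?s powr (- 9/4) * ?s)"
      unfolding o unfolding N_def trace_add trace_scaleR trace_mat_1 trace_outer by (simp add: mult_ac)
    also have "\<dots> = ?s powr (- 5/4) * (5/4 - CARD('n) / 2)"
      unfolding 1 by (simp add: algebra_simps)
    also have "\<dots> < 0" using s n by (intro mult_pos_neg) (simp_all del: powr_gt_zero add: powr_gt_zero)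
    finally show ?thesis .
  qed
  ultimately show ?thesis using that by blast
qed

text \<open>A superharmonic function bounded below does not see the puncture: adding \<open>\<epsilon>\<close> times the singular
  barrier makes \<open>u - h\<close> positive near \<open>0\<close> and strictly superharmonic, so that it has no negative interior
  minimum, and then \<open>\<epsilon>\<close> tends to \<open>0\<close>.\<close>

lemma punctured_minimum_principle:
  fixes u h :: "real^'n \<Rightarrow> real"
  assumes n: "CARD('n) \<ge> 3" and r: "r > 0"
    and uc: "continuous_on (cball 0 r - {0}) u" and hc: "continuous_on (cball 0 r) h"
    and u: "\<And>x. x \<in> ball 0 r - {0} \<Longrightarrow> \<exists>p M. has_2jet u x p M \<and> trace M \<le> 0"
    and h: "\<And>x. x \<in> ball 0 r - {0} \<Longrightarrow> \<exists>p M. has_2jet h x p M \<and> trace M \<ge> 0"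
    and bd: "\<And>x. x \<in> ball 0 r - {0} \<Longrightarrow> b \<le> u x"
    and sph: "\<And>x. x \<in> sphere 0 r \<Longrightarrow> h x \<le> u x"
    and x0: "x0 \<in> ball 0 r - {0}"
  shows "h x0 \<le> u x0"
proof -
  define B where "B x = ((norm x)^2) powr (- 1/4)" for x :: "real^'n"
  have main: "u x0 - h x0 + \<epsilon> * B x0 \<ge> 0" if \<epsilon>: "\<epsilon> > 0" for \<epsilon>
  proof (rule ccontr)
    define g where "g x = u x - h x + \<epsilon> * B x" for x
    assume "\<not> ?thesis"
    then have neg: "g x0 < 0" by (simp add: g_def)
    have "compact (h ` cball 0 r)" using hc by (intro compact_continuous_image) auto
    then obtain m where m: "\<And>x. x \<in> cball 0 r \<Longrightarrow> \<bar>h x\<bar> \<le> m"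
      using compact_imp_bounded bounded_iff by (metis imageI real_norm_def)
    define K where "K = \<bar>m\<bar> + \<bar>b\<bar> + 1"
    have K: "K > 0" by (simp add: K_def)
    define \<rho> where "\<rho> = min (norm x0) ((K / \<epsilon>) powr (- 2)) / 2"
    have \<rho>: "0 < \<rho>" "\<rho> < norm x0" "\<rho> \<le> (K / \<epsilon>) powr (- 2)"
    proof -
      have "norm x0 > 0" "(K / \<epsilon>) powr (- 2) > 0" using x0 K \<epsilon> by auto
      then show "0 < \<rho>" "\<rho> < norm x0" "\<rho> \<le> (K / \<epsilon>) powr (- 2)"
        unfolding \<rho>_def by linarith+
    qed
    have near: "g x > 0" if x: "x \<noteq> 0" "norm x \<le> \<rho>" for x
    proof -
      have "(norm x)^2 \<le> ((K / \<epsilon>) powr (- 2))^2"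
        using x \<rho> by (intro power_mono) auto
      also have "\<dots> = (K / \<epsilon>) powr (- 4)"
        using K \<epsilon> by (simp add: power2_eq_square flip: powr_add)
      finally have "((K / \<epsilon>) powr (- 4)) powr (- 1/4) \<le> B x"
        unfolding B_def using x by (intro powr_mono2') auto
      then have "K / \<epsilon> \<le> B x" using K \<epsilon> by (simp add: powr_powr)
      then have "K \<le> \<epsilon> * B x" using \<epsilon> by (simp add: field_simps)
      moreover have "x \<in> ball 0 r" using x \<rho> x0 by simp
      ultimately show ?thesis
        using bd[of x] m[of x] x by (auto simp: g_def K_def)
    qed
    define A where "A = cball (0::real^'n) r - ball 0 \<rho>"
    have A: "compact A" "x0 \<in> A" "A \<subseteq> cball 0 r - {0}"
      using \<rho> x0 by (auto simp: A_def compact_diff)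
    have "continuous_on A g"
      unfolding g_def B_def using A \<rho>
      by (intro continuous_intros continuous_on_subset[OF uc] continuous_on_subset[OF hc]) auto
    then obtain x1 where x1: "x1 \<in> A" "\<And>x. x \<in> A \<Longrightarrow> g x1 \<le> g x"
      using continuous_attains_inf[of A g] A by blast
    have g1: "g x1 < 0" using x1(2)[OF A(2)] neg by simp
    have "x1 \<notin> sphere 0 r"
    proof
      assume "x1 \<in> sphere 0 r"
      moreover have "\<epsilon> * B x1 \<ge> 0" using \<epsilon> by (simp add: B_def)
      ultimately show False using g1 sph[of x1] by (simp add: g_def)
    qed
    moreover have "\<rho> < norm x1"
      using near[of x1] g1 x1(1) \<rho> by (force simp: A_def not_less)
    ultimately have x1U: "x1 \<in> ball 0 r - cball 0 \<rho>" using x1(1) by (auto simp: A_def)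
    then have x1b: "x1 \<in> ball 0 r - {0}" "x1 \<noteq> 0" using \<rho> by auto
    obtain p1 M1 p2 M2 p3 M3 where j: "has_2jet u x1 p1 M1" "trace M1 \<le> 0"
      "has_2jet h x1 p2 M2" "trace M2 \<ge> 0" "has_2jet B x1 p3 M3" "trace M3 < 0"
      using u[OF x1b(1)] h[OF x1b(1)] singular_barrier[OF n x1b(2)] unfolding B_def by metis
    have jg: "has_2jet g x1 (p1 - p2 + \<epsilon> *\<^sub>R p3) (M1 - M2 + \<epsilon> *\<^sub>R M3)"
      unfolding g_def by (intro has_2jet_add has_2jet_diff has_2jet_cmult j)
    have "open (ball (0::real^'n) r - cball 0 \<rho>)" by (intro open_Diff) auto
    from has_2jet_local_min(2)[OF jg this x1U]
    have "trace (M1 - M2 + \<epsilon> *\<^sub>R M3) \<ge> 0"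
      using x1(2) by (intro trace_psd_nonneg) (auto simp: A_def)
    moreover have "trace (M1 - M2 + \<epsilon> *\<^sub>R M3) = trace M1 - trace M2 + \<epsilon> * trace M3"
      by (simp add: trace_add trace_sub trace_scaleR)
    moreover have "\<epsilon> * trace M3 < 0" using \<epsilon> j by (simp add: mult_pos_neg)
    ultimately show False using j by simp
  qed
  have B0: "B x0 > 0" using x0 by (simp add: B_def)
  have "h x0 - u x0 \<le> 0"
  proof (rule field_le_epsilon)
    fix e :: real assume "e > 0"
    then show "h x0 - u x0 \<le> 0 + e" using main[of "e / B x0"] B0 by simp
  qed
  then show ?thesis by simp
qed

lemma isCont_0_near:
  fixes f :: "'a::real_normed_vector \<Rightarrow> 'b::real_normed_vector"
  assumes "isCont f 0" "e > 0"
  obtains d where "d > 0" "\<And>x. norm x < d \<Longrightarrow> norm (f x - f 0) < e"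
  using assms unfolding continuous_at_eps_delta by (metis diff_zero dist_norm)

text \<open>A superharmonic function cannot touch the corner \<open>max f g\<close> at the puncture: its value there would have
  to be at least its mean over a small sphere, while the corner has mean larger than \<open>m\<close> by a
  multiple of the radius. Instead of means, the proof uses an explicit harmonic quadratic polynomial
  \<open>h\<close> with \<open>h \<le> max f g\<close> on the sphere of radius \<open>r\<close> and \<open>h 0 > m\<close>.\<close>

lemma corner_lower_bound:
  fixes u f g :: "real^'n \<Rightarrow> real"
  assumes n: "CARD('n) \<ge> 3" and R: "R > 0" and u: "C2_on (ball 0 R - {0}) u"
    and lap: "\<And>x. x \<in> ball 0 R - {0} \<Longrightarrow> laplacian u x \<le> 0"
    and f: "(f has_derivative (\<lambda>h. p \<bullet> h)) (at 0)" "f 0 = m" "\<And>x. x \<in> ball 0 R - {0} \<Longrightarrow> f x \<le> u x"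
    and g: "(g has_derivative (\<lambda>h. q \<bullet> h)) (at 0)" "g 0 = m" "\<And>x. x \<in> ball 0 R - {0} \<Longrightarrow> g x \<le> u x"
    and pq: "p \<noteq> q"
  obtains c \<rho> where "c > m" "\<rho> > 0" "\<And>x. x \<in> ball 0 \<rho> - {0} \<Longrightarrow> c \<le> u x"
proof -
  define d c where "d = (1/2) *\<^sub>R (p - q)" and "c = (1/2) *\<^sub>R (p + q)"
  define D where "D = norm d"
  have D: "D > 0" using pq by (simp add: D_def d_def)
  define n' where "n' = real CARD('n)"
  have n': "n' > 0" using n by (simp add: n'_def)
  \<comment> \<open>Half of the gain \<open>D r / n\<close> at the centre, to absorb the errors of the linear approximations.\<close>
  define \<epsilon> where "\<epsilon> = D / (2 * n')"
  have \<epsilon>: "\<epsilon> > 0" using D n' by (simp add: \<epsilon>_def)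
  obtain d1 where d1: "d1 > 0" "\<And>x. norm x < d1 \<Longrightarrow> \<bar>f x - m - p \<bullet> x\<bar> \<le> \<epsilon> * norm x"
    using f(1) \<epsilon> unfolding has_derivative_at_alt by (force simp: f(2))
  obtain d2 where d2: "d2 > 0" "\<And>x. norm x < d2 \<Longrightarrow> \<bar>g x - m - q \<bullet> x\<bar> \<le> \<epsilon> * norm x"
    using g(1) \<epsilon> unfolding has_derivative_at_alt by (force simp: g(2))
  define r where "r = Min {R, d1, d2} / 2"
  have r: "0 < r" "r < R" "r < d1" "r < d2" using R d1 d2 by (auto simp: r_def min_def)
  \<comment> \<open>With \<open>p = c + d\<close> and \<open>q = c - d\<close> the corner is \<open>m + c \<bullet> x + \<bar>d \<bullet> x\<bar>\<close> to first order, and on the sphere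
      \<open>\<bar>d \<bullet> x\<bar> \<ge> (d \<bullet> x)\<^sup>2 / (D r)\<close>. Subtracting the multiple of \<open>\<bar>x\<bar>\<^sup>2\<close> that makes the right-hand side harmonic
      is compensated on the sphere by the constant \<open>D r / n\<close>.\<close>
  define N where "N = (2 / (D * r)) *\<^sub>R outer d + (- 2 * D / (n' * r)) *\<^sub>R mat 1"
  define c0 where "c0 = m + D * r / n' - \<epsilon> * r"
  define h where "h x = c0 + c \<bullet> (x - 0) + (1/2) * ((x - 0) \<bullet> (N *v (x - 0)))" for x
  have jh: "has_2jet h x (c + N *v (x - 0)) N" for x
    unfolding h_def
    by (rule has_2jet_quadratic) (simp only: N_def transpose_add transpose_scaleR transpose_outer transpose_mat)
  have "trace N = 0"
    unfolding N_def trace_add trace_scaleR trace_mat_1 trace_outer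
    using D r n' by (simp add: power2_eq_square flip: D_def n'_def)
  have h_eq: "h x = c0 + c \<bullet> x + (d \<bullet> x)^2 / (D * r) - D * (norm x)^2 / (n' * r)" for x
    unfolding h_def N_def matrix_vector_mult_add_rdistrib scaleR_matrix_vector_assoc[symmetric] outer_mult_vec
    by (simp add: inner_add_right inner_diff_right inner_commute dot_square_norm power2_eq_square add_divide_distrib mult_ac)
  have c0: "c0 > m" using D r n' by (simp add: c0_def \<epsilon>_def field_simps)
  have sph: "h x \<le> u x" if x: "x \<in> sphere 0 r" for x
  proof -
    have nx: "norm x = r" using x by simp
    have xR: "x \<in> ball 0 R - {0}" using nx r by auto
    have "\<bar>d \<bullet> x\<bar> \<le> D * r" using Cauchy_Schwarz_ineq2[of d x] by (simp add: nx D_def)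
    then have "\<bar>d \<bullet> x\<bar> * \<bar>d \<bullet> x\<bar> \<le> \<bar>d \<bullet> x\<bar> * (D * r)" by (intro mult_left_mono) auto
    then have "(d \<bullet> x)^2 / (D * r) \<le> \<bar>d \<bullet> x\<bar>"
      using D r by (simp add: power2_eq_square divide_le_eq)
    moreover have "D * r^2 / (n' * r) = D * r / n'" using r by (simp add: power2_eq_square)
    ultimately have "h x \<le> m - \<epsilon> * r + c \<bullet> x + \<bar>d \<bullet> x\<bar>" by (simp add: h_eq nx c0_def)
    moreover have "c \<bullet> x + d \<bullet> x = p \<bullet> x" "c \<bullet> x - d \<bullet> x = q \<bullet> x"
      by (simp_all add: c_def d_def inner_add_left inner_diff_left field_simps)
    moreover have "m + p \<bullet> x - \<epsilon> * r \<le> u x" "m + q \<bullet> x - \<epsilon> * r \<le> u x"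
      using d1(2)[of x] d2(2)[of x] f(3)[OF xR] g(3)[OF xR] r by (auto simp: nx abs_le_iff)
    ultimately show ?thesis by (auto simp: abs_if split: if_splits)
  qed
  have bd: "m - (norm p + \<epsilon>) * r \<le> u x" if x: "x \<in> ball 0 r - {0}" for x
  proof -
    have "\<bar>p \<bullet> x\<bar> \<le> norm p * r"
      using Cauchy_Schwarz_ineq2[of p x] x mult_left_mono[of "norm x" r "norm p"] by simp
    moreover have "\<epsilon> * norm x \<le> \<epsilon> * r" using x \<epsilon> by simp
    ultimately show ?thesis
      using d1(2)[of x] f(3)[of x] x r by (auto simp: algebra_simps abs_le_iff)
  qed
  have op: "open (ball (0::real^'n) R - {0})" by auto
  have hu: "h x \<le> u x" if "x \<in> ball 0 r - {0}" for x
  proof (rule punctured_minimum_principle[OF n r(1) _ _ _ _ bd sph that])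
    show "continuous_on (cball 0 r - {0}) u"
      using r by (intro continuous_on_subset[OF C2_on_continuous(1)[OF u op]]) auto
    show "continuous_on (cball 0 r) h"
      using has_2jet_continuous[OF jh] by (simp add: continuous_at_imp_continuous_on)
    show "\<exists>p M. has_2jet u x p M \<and> trace M \<le> 0" if "x \<in> ball 0 r - {0}" for x
      using C2_on_has_2jet[OF u op, of x] lap[of x] that r unfolding laplacian_def by auto
    show "\<exists>p M. has_2jet h x p M \<and> 0 \<le> trace M" for x
      using jh[of x] \<open>trace N = 0\<close> by (intro exI[of _ "c + N *v (x - 0)"] exI[of _ N]) simp
  qed auto
  have "isCont h 0" "(c0 - m) / 2 > 0" using has_2jet_continuous[OF jh] c0 by auto
  from isCont_0_near[OF this] obtain \<rho> where \<rho>: "\<rho> > 0" "\<And>x. norm x < \<rho> \<Longrightarrow> norm (h x - h 0) < (c0 - m) / 2"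
    by blast
  show ?thesis
  proof (rule that[of "(m + c0) / 2" "min \<rho> r"])
    show "(m + c0) / 2 \<le> u x" if "x \<in> ball 0 (min \<rho> r) - {0}" for x
    proof -
      have "\<bar>h x - c0\<bar> < (c0 - m) / 2" using \<rho>(2)[of x] that by (simp add: h_eq)
      moreover have "h x \<le> u x" using hu[of x] that by simp
      ultimately show ?thesis
        using abs_ge_minus_self[of "h x - c0"] by (simp add: field_simps)
    qed
  qed (use c0 \<rho> r in auto)
qed

section \<open>Sliding the rescaled translates\<close>

text \<open>The exponent \<open>a\<close> stands for \<open>(n - 2) / 2\<close>; the translate by \<open>h\<close> comes before the scaling, so
  that the value at the origin is \<open>l powr a * v h\<close>.\<close>

definition rescaled_translate :: "real \<Rightarrow> (real^'n \<Rightarrow> real) \<Rightarrow> real \<Rightarrow> real^'n \<Rightarrow> real^'n \<Rightarrow> real" where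
  "rescaled_translate a v l h x = l powr a * v (l *\<^sub>R x + h)"

lemma jet_in_jet_domain:
  assumes "C2_on S f" "open S" "x \<in> S" "f x > 0"
  shows "jet f x \<in> jet_domain"
  using assms has_2jet_symmetric[OF C2_on_has_2jet[OF assms(1-3)]]
  by (simp add: jet_def jet_domain_def sym_mats_def)

lemma continuous_on_jet:
  assumes "C2_on S f" "open S" shows "continuous_on S (jet f)"
  unfolding jet_def using C2_on_continuous[OF assms] assms(1)
  by (intro continuous_intros) (auto simp: C2_on_def)

lemma has_2jet_rescaled_translate:
  assumes "C2_on S v" "open S" "l *\<^sub>R x + h \<in> S"
  shows "has_2jet (rescaled_translate a v l h) x ((l powr a * l) *\<^sub>R grad v (l *\<^sub>R x + h))
    ((l powr a * l^2) *\<^sub>R hess v (l *\<^sub>R x + h))"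
  unfolding rescaled_translate_def[abs_def]
  by (rule has_2jet_rescale[OF C2_on_has_2jet[OF assms]])

lemma C2_on_rescaled_translate:
  assumes v: "C2_on S v" "open S" and U: "\<And>x. x \<in> U \<Longrightarrow> l *\<^sub>R x + h \<in> S"
  shows "C2_on U (rescaled_translate a v l h)"
proof (rule C2_onI)
  show "has_2jet (rescaled_translate a v l h) x ((l powr a * l) *\<^sub>R grad v (l *\<^sub>R x + h))
    ((l powr a * l^2) *\<^sub>R hess v (l *\<^sub>R x + h))" if "x \<in> U" for x
    by (rule has_2jet_rescaled_translate[OF v U[OF that]])
  have "continuous_on S (hess v)" using v by (simp add: C2_on_def)
  then have "continuous_on U (\<lambda>x. hess v (l *\<^sub>R x + h))"
    by (rule continuous_on_compose2) (use U in \<open>auto intro!: continuous_intros\<close>)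
  then show "continuous_on U (\<lambda>x. (l powr a * l^2) *\<^sub>R hess v (l *\<^sub>R x + h))"
    by (intro continuous_intros)
qed

lemma operator_rescaled_translate:
  fixes v :: "real^'n \<Rightarrow> real"
  assumes inv: "scaling_invariant T" and a: "a = (real CARD('n) - 2) / 2" and l: "l > 0"
    and v: "C2_on S v" "open S" "l *\<^sub>R x + h \<in> S" "v (l *\<^sub>R x + h) > 0"
  shows "T (jet (rescaled_translate a v l h) x) = T (jet v (l *\<^sub>R x + h))"
proof -
  have "jet (rescaled_translate a v l h) x = (l powr a * v (l *\<^sub>R x + h),
      (l powr a * l) *\<^sub>R grad v (l *\<^sub>R x + h), (l powr a * l^2) *\<^sub>R hess v (l *\<^sub>R x + h))"
    using has_2jetD[OF has_2jet_rescaled_translate[OF v(1-3)]] by (simp add: jet_def rescaled_translate_def)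
  then show ?thesis
    using scaling_invariant_jet[OF inv v(4) has_2jet_symmetric[OF C2_on_has_2jet[OF v(1-3)]] l a]
    by (simp add: jet_def)
qed

text \<open>Translates move the puncture of \<open>v\<close> into the punctured ball of \<open>u\<close>, so the inequality for \<open>v\<close> is needed
  there as well; it extends by continuity.\<close>

lemma subsolution_at_puncture:
  fixes v :: "real^'n \<Rightarrow> real"
  assumes C1: "C1_on jet_domain T" and v: "C2_on (ball 0 R) v" "\<forall>x\<in>ball 0 R. v x > 0"
    and T: "\<forall>x\<in>ball 0 R - {0}. T (jet v x) \<le> 0" and x: "x \<in> ball 0 R"
  shows "T (jet v x) \<le> 0"
proof (cases "x = 0")
  case True
  have "continuous_on (ball 0 R) (\<lambda>x. T (jet v x))"
    using jet_in_jet_domain[OF v(1)] v(2)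
    by (intro continuous_on_compose2[OF C1_on_continuous_on[OF C1] continuous_on_jet[OF v(1)]]) auto
  then have "isCont (\<lambda>x. T (jet v x)) 0"
    using x True continuous_on_eq_continuous_at[OF open_ball] by blast
  then have "((\<lambda>x. T (jet v x)) \<longlongrightarrow> T (jet v 0)) (at 0)" by (simp add: isCont_def)
  moreover have "\<forall>\<^sub>F x in at 0. T (jet v x) \<le> 0"
    unfolding eventually_at using T x True by (intro exI[of _ R]) auto
  ultimately show ?thesis
    using True tendsto_upperbound[of "\<lambda>x. T (jet v x)" _ "at 0" 0] by (simp add: trivial_limit_at)
next
  case False
  then show ?thesis using T x by blast
qed

text \<open>The translates increase with \<open>l\<close> and lie below \<open>u\<close> for \<open>l = 1/2\<close>. If \<open>u\<close> were met before \<open>l\<close> reaches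
  \<open>L\<close>, consider the first meeting. It happens neither on the sphere, nor near the origin, where
  the translates with \<open>l < L\<close> are below \<open>v\<close>; so it happens at an interior point of the punctured ball, and the strong
  maximum principle makes \<open>u\<close> equal to a translate up to the origin, a contradiction.\<close>

lemma rescaled_translate_below:
  fixes T :: "real \<times> (real^'n) \<times> (real^'n^'n) \<Rightarrow> real" and u v :: "real^'n \<Rightarrow> real"
  assumes n: "CARD('n) \<ge> 3" and C1: "C1_on jet_domain T" and ell: "elliptic T"
    and inv: "scaling_invariant T" and a: "a = (real CARD('n) - 2) / 2"
    and u: "C2_on (ball 0 2 - {0}) u" and v: "C2_on (ball 0 2) v" "\<forall>x \<in> ball 0 2. v x > 0"
    and uv: "\<forall>x \<in> ball 0 2 - {0}. u x > v x"
    and Tuv: "\<forall>x \<in> ball 0 2 - {0}. T (jet u x) \<ge> 0 \<and> 0 \<ge> T (jet v x)"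
    and r: "0 < r" "r \<le> 1/2" "norm h \<le> r" and L: "1/2 < L" "L \<le> 2"
    and mono: "\<And>x l l'. norm x \<le> r \<Longrightarrow> 1/2 \<le> l \<Longrightarrow> l \<le> l' \<Longrightarrow> l' \<le> 2 \<Longrightarrow>
       rescaled_translate a v l h x \<le> rescaled_translate a v l' h x"
    and start: "\<And>x. x \<noteq> 0 \<Longrightarrow> norm x \<le> r \<Longrightarrow> rescaled_translate a v (1/2) h x < u x"
    and sph: "\<And>x. norm x = r \<Longrightarrow> rescaled_translate a v L h x < u x"
    and center: "L powr a * v h \<le> v 0"
    and x: "x \<noteq> 0" "norm x \<le> r"
  shows "rescaled_translate a v L h x \<le> u x"
proof -
  let ?W = "\<lambda>l. rescaled_translate a v l h"
  have a0: "a > 0" using n by (simp add: a)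
  have inB: "l *\<^sub>R x + h \<in> ball 0 2" if "norm x \<le> r" "1/2 \<le> l" "l \<le> 2" for x l
  proof -
    have "norm (l *\<^sub>R x + h) \<le> l * norm x + norm h"
      using norm_triangle_ineq[of "l *\<^sub>R x" h] that by simp
    also have "\<dots> \<le> 2 * r + r" using that r by (intro add_mono mult_mono) auto
    finally show ?thesis using r by simp
  qed
  have opu: "open (ball (0::real^'n) 2 - {0})" by auto
  have uc: "continuous_on (ball 0 2 - {0}) u" using C2_on_continuous(1)[OF u opu] .
  have vc: "continuous_on (ball 0 2) v" using C2_on_continuous(1)[OF v(1) open_ball] .
  have Wc: "continuous_on ({1/2..2} \<times> cball 0 r) (\<lambda>z. ?W (fst z) (snd z))"
    unfolding rescaled_translate_def
    by (intro continuous_intros continuous_on_compose2[OF vc]) (auto intro!: inB)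
  have Wl: "continuous_on {1/2..2} (\<lambda>l. ?W l x)" if "norm x \<le> r" for x
    by (rule continuous_on_compose2[OF Wc, of _ "\<lambda>l. (l, x)", simplified])
       (use that in \<open>auto intro!: continuous_intros\<close>)
  have Wx: "continuous_on (cball 0 r) (?W l)" if "1/2 \<le> l" "l \<le> 2" for l
    by (rule continuous_on_compose2[OF Wc, of _ "\<lambda>x. (l, x)", simplified])
       (use that in \<open>auto intro!: continuous_intros\<close>)
  have limit: "?W l x \<le> u x" if l: "1/2 < l" "l \<le> 2" "norm x \<le> r"
    and below: "\<And>l'. 1/2 \<le> l' \<Longrightarrow> l' < l \<Longrightarrow> ?W l' x < u x" for l x
  proof -
    have "((\<lambda>l. ?W l x) \<longlongrightarrow> ?W l x) (at l within {1/2..<l})"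
      using Wl[OF l(3)] l unfolding continuous_on_def by (force intro: tendsto_within_subset)
    moreover have "\<forall>\<^sub>F l' in at l within {1/2..<l}. ?W l' x \<le> u x"
      unfolding eventually_at_filter using below by (auto intro!: always_eventually less_imp_le)
    moreover have "at l within {1/2..<l} \<noteq> bot"
      using l by (simp add: at_within_eq_bot_iff closure_atLeastLessThan)
    ultimately show ?thesis using tendsto_upperbound by blast
  qed
  have claim: "?W l x < u x" if l: "1/2 \<le> l" "l < L" and x: "x \<noteq> 0" "norm x \<le> r" for l x
  proof (rule ccontr)
    assume neg: "\<not> ?thesis"
    have "h \<in> ball 0 2" using r by simp
    then have vh: "v h > 0" using v by blast
    have "?W l 0 < v 0"
      using powr_less_mono2[OF a0 _ l(2)] l(1) vh center
      by (simp add: rescaled_translate_def) (meson mult_strict_right_mono order_less_le_trans)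
    moreover have "continuous_on (ball 0 r) (\<lambda>y. ?W l y - v y)"
      by (intro continuous_intros continuous_on_subset[OF Wx] continuous_on_subset[OF vc]) (use l L r in auto)
    then have "isCont (\<lambda>y. ?W l y - v y) 0"
      using r continuous_on_eq_continuous_at[OF open_ball] by (metis centre_in_ball)
    ultimately obtain \<rho> where \<rho>0: "\<rho> > 0"
      "\<And>y. norm y < \<rho> \<Longrightarrow> norm ((?W l y - v y) - (?W l 0 - v 0)) < v 0 - ?W l 0"
      using isCont_0_near[of "\<lambda>y. ?W l y - v y" "v 0 - ?W l 0"] by auto
    have below_v: "?W l y < v y" if "norm y < \<rho>" for y
      using \<rho>0(2)[OF that] abs_ge_self[of "(?W l y - v y) - (?W l 0 - v 0)"] unfolding real_norm_def by linarith
    note \<rho> = \<rho>0(1) below_v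
    have near: "?W l' y < u y" if "1/2 \<le> l'" "l' \<le> l" "y \<noteq> 0" "norm y < \<rho>" "norm y \<le> r" for l' y
    proof -
      have "?W l' y \<le> ?W l y" using mono that l L by simp
      also have "\<dots> < v y" using \<rho> that by blast
      also have "\<dots> < u y" using uv that r by auto
      finally show ?thesis .
    qed
    define A where "A = {1/2..l} \<times> (cball (0::real^'n) r - ball 0 \<rho>)"
    define K where "K = A \<inter> (\<lambda>z. u (snd z) - ?W (fst z) (snd z)) -` {..0}"
    have compA: "compact A" unfolding A_def by (intro compact_Times compact_diff compact_cball open_ball compact_Icc)
    have "continuous_on A (\<lambda>z. u (snd z) - ?W (fst z) (snd z))"
      using l L r \<rho>
      by (intro continuous_on_diff continuous_on_subset[OF Wc] continuous_on_compose2[OF uc] continuous_intros)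
         (auto simp: A_def)
    then have "closed K"
      unfolding K_def using compA by (intro continuous_closed_preimage) (auto simp: compact_imp_closed)
    moreover have "A \<inter> K = K" by (auto simp: K_def)
    ultimately have "compact K" using compact_Int_closed[OF compA] by metis
    moreover have "(l, x) \<in> K"
      using neg x l near[of l x] by (force simp: K_def A_def not_less)
    ultimately obtain z where z: "z \<in> K" "\<And>z'. z' \<in> K \<Longrightarrow> fst z \<le> fst z'"
      using continuous_attains_inf[of K fst] continuous_on_fst[OF continuous_on_id] by (metis empty_iff)
    obtain l0 x0 where z0: "z = (l0, x0)" by fastforce
    have l0: "1/2 \<le> l0" "l0 \<le> l" and x0: "norm x0 \<le> r" "\<rho> \<le> norm x0" "u x0 \<le> ?W l0 x0"
      using z(1) by (auto simp: z0 K_def A_def)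
    have x0n: "x0 \<noteq> 0" using x0 \<rho> by auto
    have "l0 \<noteq> 1/2"
    proof
      assume "l0 = 1/2"
      then have "?W l0 x0 < u x0" using start[OF x0n x0(1)] by (simp only:)
      then show False using x0(3) by simp
    qed
    then have l0': "1/2 < l0" using l0 by simp
    have below: "?W l' y < u y" if "1/2 \<le> l'" "l' < l0" "y \<noteq> 0" "norm y \<le> r" for l' y
    proof (rule ccontr)
      assume "\<not> ?thesis"
      then have "(l', y) \<in> K" using that near[of l' y] l0 by (force simp: K_def A_def not_less)
      then show False using z(2)[of "(l', y)"] that by (simp add: z0)
    qed
    have le: "?W l0 y \<le> u y" if "y \<noteq> 0" "norm y \<le> r" for y
      by (rule limit) (use l0 l0' l L that below in auto)
    have "norm x0 \<noteq> r"
    proof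
      assume "norm x0 = r"
      moreover have "?W l0 x0 \<le> ?W L x0" using mono x0 l0 l L by simp
      ultimately show False using sph x0(3) by fastforce
    qed
    then have x0b: "x0 \<in> ball 0 r - {0}" using x0 x0n by simp
    have l0L: "0 < l0" "l0 \<le> 2" using l0 l L by auto
    have eq: "u y = ?W l0 y" if "y \<in> ball 0 r - {0}" for y
    proof (rule strong_maximum_principle[OF C1 ell _ _ _ _ _ _ _ _ x0b _ that])
      show "open (ball (0::real^'n) r - {0})" by auto
      show "connected (ball (0::real^'n) r - {0})" using n by (intro connected_punctured_ball) simp
      show "C2_on (ball 0 r - {0}) u"
        using u r unfolding C2_on_def by (auto intro: continuous_on_subset)
      show "C2_on (ball 0 r - {0}) (?W l0)"
        by (rule C2_on_rescaled_translate[OF v(1) open_ball]) (use inB l0 l0L in auto)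
      fix y assume y: "y \<in> ball (0::real^'n) r - {0}"
      then have yB: "l0 *\<^sub>R y + h \<in> ball 0 2" using inB l0 l0L by auto
      show "0 < ?W l0 y" using v(2) yB l0L by (simp add: rescaled_translate_def)
      show "?W l0 y \<le> u y" using le y by auto
      show "0 \<le> T (jet u y)" using Tuv y r by auto
      have "T (jet (?W l0) y) = T (jet v (l0 *\<^sub>R y + h))"
        by (rule operator_rescaled_translate[OF inv a l0L(1) v(1) open_ball yB]) (use v(2) yB in blast)
      also have "\<dots> \<le> 0"
        by (rule subsolution_at_puncture[OF C1 v _ yB]) (use Tuv in blast)
      finally show "T (jet (?W l0) y) \<le> 0" .
    next
      show "u x0 = ?W l0 x0" using x0(3) le[OF x0n x0(1)] by simp
    qed
    define y :: "real^'n" where "y = (min \<rho> r / 2) *\<^sub>R axis undefined 1"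
    have "norm y = min \<rho> r / 2" using \<rho> r by (simp add: y_def)
    then have "0 < norm y" "norm y < \<rho>" "norm y < r" using \<rho> r by auto
    then show False using eq[of y] near[of l0 y] l0 by auto
  qed
  show ?thesis by (rule limit) (use L x claim in auto)
qed

text \<open>Near the origin the derivative with respect to \<open>l\<close> is dominated by \<open>a * v\<close>, the term coming
  from the amplitude, because the term \<open>grad v \<bullet> x\<close> carries a small factor \<open>x\<close>.\<close>

lemma rescaled_translate_increasing:
  fixes v :: "real^'n \<Rightarrow> real"
  assumes v: "C2_on (ball 0 2) v" and v0: "v 0 > 0" and a: "a > 0"
  obtains r where "r > 0" "\<And>x h l l'. norm x \<le> r \<Longrightarrow> norm h \<le> r \<Longrightarrow> 1/2 \<le> l \<Longrightarrow> l \<le> l' \<Longrightarrow> l' \<le> 2 \<Longrightarrow>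
     rescaled_translate a v l h x \<le> rescaled_translate a v l' h x"
proof -
  have cont: "isCont v 0" "isCont (grad v) 0"
    using C2_on_continuous[OF v open_ball] continuous_on_eq_continuous_at[OF open_ball]
    by (metis centre_in_ball zero_less_numeral)+
  define G where "G = norm (grad v 0) + 1"
  have G: "G > 0" by (simp add: G_def add_nonneg_pos)
  obtain d1 where d1: "d1 > 0" "\<And>y. norm y < d1 \<Longrightarrow> norm (v y - v 0) < v 0 / 2"
    using isCont_0_near[OF cont(1), of "v 0 / 2"] v0 by auto
  obtain d2 where d2: "d2 > 0" "\<And>y. norm y < d2 \<Longrightarrow> norm (grad v y - grad v 0) < 1"
    using isCont_0_near[OF cont(2), of 1] by auto
  define d where "d = min d1 d2"
  have d: "d > 0" "\<And>y. norm y < d \<Longrightarrow> v y > v 0 / 2" "\<And>y. norm y < d \<Longrightarrow> norm (grad v y) < G"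
  proof -
    show "d > 0" using d1 d2 by (simp add: d_def)
    show "v y > v 0 / 2" if "norm y < d" for y
      using d1(2)[of y] that abs_ge_minus_self[of "v y - v 0"] by (simp add: d_def field_simps)
    show "norm (grad v y) < G" if "norm y < d" for y
      using d2(2)[of y] that norm_triangle_ineq2[of "grad v y" "grad v 0"] by (simp add: d_def G_def)
  qed
  define r where "r = Min {d / 4, 1/2, a * v 0 / (4 * G)}"
  have r: "r > 0" "r \<le> d / 4" "r \<le> 1/2" "r \<le> a * v 0 / (4 * G)"
    using d v0 a G by (auto simp: r_def)
  show ?thesis
  proof (rule that[OF r(1)])
    fix x h :: "real^'n" and l l' :: real
    assume x: "norm x \<le> r" and h: "norm h \<le> r" and l: "1/2 \<le> l" "l \<le> l'" "l' \<le> 2"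
    show "rescaled_translate a v l h x \<le> rescaled_translate a v l' h x"
    proof (rule DERIV_nonneg_imp_nondecreasing[OF l(2)])
      fix t assume t: "l \<le> t" "t \<le> l'"
      define y where "y = t *\<^sub>R x + h"
      have tr: "0 < t" "t \<le> 2" using t l by auto
      have "norm y \<le> t * norm x + norm h"
        unfolding y_def using norm_triangle_ineq[of "t *\<^sub>R x" h] tr by simp
      also have "\<dots> \<le> 2 * r + r" using x h tr r by (intro add_mono mult_mono) auto
      finally have y: "norm y \<le> 3 * r" by simp
      then have yd: "norm y < d" "y \<in> ball 0 2" using r by auto
      have "(v has_derivative (\<lambda>z. grad v y \<bullet> z)) (at (t *\<^sub>R x + h))"
        using has_derivative_grad v yd unfolding C2_on_def y_def by blast
      moreover have "((\<lambda>t. t *\<^sub>R x + h) has_derivative (\<lambda>s. s *\<^sub>R x)) (at t)"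
        by (auto intro!: derivative_eq_intros)
      ultimately have "((\<lambda>t. v (t *\<^sub>R x + h)) has_derivative (\<lambda>s. s * (grad v y \<bullet> x))) (at t)"
        using has_derivative_compose by fastforce
      then have dv: "((\<lambda>t. v (t *\<^sub>R x + h)) has_real_derivative (grad v y \<bullet> x)) (at t)"
        unfolding has_field_derivative_def by (rule has_derivative_eq_rhs) (simp add: fun_eq_iff)
      have "((\<lambda>t. t powr a) has_real_derivative (a * t powr (a - 1))) (at t)"
        using tr by (auto intro!: derivative_eq_intros)
      from DERIV_mult[OF this dv]
      have "((\<lambda>t. rescaled_translate a v t h x) has_real_derivative
          (a * t powr (a - 1) * v y + (grad v y \<bullet> x) * t powr a)) (at t)"
        by (simp add: rescaled_translate_def y_def)
      moreover have "a * t powr (a - 1) * v y + (grad v y \<bullet> x) * t powr a \<ge> 0"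
      proof -
        have "\<bar>grad v y \<bullet> x\<bar> \<le> norm (grad v y) * norm x" by (rule Cauchy_Schwarz_ineq2)
        also have "\<dots> \<le> G * (a * v 0 / (4 * G))"
          using d(3)[OF yd(1)] x r G by (intro mult_mono) auto
        also have "\<dots> = a * v 0 / 4" using G by simp
        finally have "\<bar>grad v y \<bullet> x\<bar> * t \<le> a * v 0 / 4 * 2"
          using tr a v0 by (intro mult_mono) auto
        moreover have "a * (v 0 / 2) \<le> a * v y"
          using d(2)[OF yd(1)] a by (intro mult_left_mono) auto
        moreover have "- (\<bar>grad v y \<bullet> x\<bar> * t) \<le> (grad v y \<bullet> x) * t"
          using tr by (simp add: abs_if)
        ultimately have "0 \<le> a * v y + (grad v y \<bullet> x) * t" by simp
        then have "0 \<le> t powr (a - 1) * (a * v y + (grad v y \<bullet> x) * t)" by simp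
        also have "t powr (a - 1) * (a * v y + (grad v y \<bullet> x) * t) =
            a * t powr (a - 1) * v y + (grad v y \<bullet> x) * (t powr (a - 1) * t powr 1)"
          using tr by (simp add: algebra_simps)
        also have "t powr (a - 1) * t powr 1 = t powr a" unfolding powr_add[symmetric] by simp
        finally show ?thesis .
      qed
      ultimately show "\<exists>y. ((\<lambda>t. rescaled_translate a v t h x) has_real_derivative y) (at t) \<and> 0 \<le> y" by blast
    qed
  qed
qed

text \<open>The scale \<open>(v 0 / v h) powr (1 / a)\<close> is the one for which the translate by \<open>h\<close> has the value \<open>v 0\<close> at
  the origin. It tends to \<open>1\<close> as \<open>h\<close> tends to \<open>0\<close>, so the strict inequality \<open>v < u\<close> on the sphere
  persists for small \<open>h\<close>.\<close>

lemma matched_translates_below: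
  fixes T :: "real \<times> (real^'n) \<times> (real^'n^'n) \<Rightarrow> real" and u v :: "real^'n \<Rightarrow> real"
  assumes n: "CARD('n) \<ge> 3" and C1: "C1_on jet_domain T" and ell: "elliptic T"
    and inv: "scaling_invariant T" and a: "a = (real CARD('n) - 2) / 2"
    and u: "C2_on (ball 0 2 - {0}) u" and v: "C2_on (ball 0 2) v" "\<forall>x \<in> ball 0 2. v x > 0"
    and uv: "\<forall>x \<in> ball 0 2 - {0}. u x > v x"
    and Tuv: "\<forall>x \<in> ball 0 2 - {0}. T (jet u x) \<ge> 0 \<and> 0 \<ge> T (jet v x)"
  obtains r k where "0 < r" "0 < k" "k \<le> 2" "r \<le> 1/2"
    "\<And>x h. x \<noteq> 0 \<Longrightarrow> norm x \<le> r \<Longrightarrow> norm h < k \<Longrightarrow>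
        rescaled_translate a v ((v 0 / v h) powr (1/a)) h x \<le> u x"
proof -
  have a0: "a > 0" using n by (simp add: a)
  define m where "m = v 0"
  have m: "m > 0" using v by (simp add: m_def)
  have vc: "continuous_on (ball 0 2) v" using C2_on_continuous(1)[OF v(1) open_ball] .
  then have vC: "isCont v 0" using continuous_on_eq_continuous_at[OF open_ball] by (metis centre_in_ball zero_less_numeral)
  obtain r1 where r1: "r1 > 0" "\<And>x h l l'. norm x \<le> r1 \<Longrightarrow> norm h \<le> r1 \<Longrightarrow> 1/2 \<le> l \<Longrightarrow> l \<le> l' \<Longrightarrow> l' \<le> 2 \<Longrightarrow>
     rescaled_translate a v l h x \<le> rescaled_translate a v l' h x"
    using rescaled_translate_increasing[OF v(1) _ a0] m unfolding m_def by metis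
  define \<kappa> where "\<kappa> = (1/2 :: real) powr a"
  have \<kappa>: "0 < \<kappa>" "\<kappa> < 1" using powr_less_mono2[OF a0, of "1/2" 1] by (simp_all add: \<kappa>_def)
  \<comment> \<open>Small enough for \<open>\<kappa> * (m + e) < m - e\<close>: at scale \<open>1/2\<close> the translates start below \<open>v\<close>.\<close>
  define e where "e = m * (1 - \<kappa>) / 2"
  have e: "e > 0" using m \<kappa> by (simp add: e_def)
  obtain r2 where r2: "r2 > 0" "\<And>y. norm y < r2 \<Longrightarrow> \<bar>v y - m\<bar> < e"
    using isCont_0_near[OF vC e] by (auto simp: m_def)
  define r where "r = Min {r1, r2 / 4, 1/2}"
  have r: "0 < r" "r \<le> r1" "r \<le> r2 / 4" "r \<le> 1/2" using r1 r2 by (auto simp: r_def)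
  have start: "rescaled_translate a v (1/2) h x < u x" if "x \<noteq> 0" "norm x \<le> r" "norm h \<le> r" for x h
  proof -
    have "norm ((1/2) *\<^sub>R x + h) \<le> (1/2) * norm x + norm h"
      using norm_triangle_ineq[of "(1/2) *\<^sub>R x" h] by simp
    then have "norm ((1/2) *\<^sub>R x + h) < r2" using that r r2 by simp
    then have "v ((1/2) *\<^sub>R x + h) < m + e" using r2(2)[of "(1/2) *\<^sub>R x + h"] by (simp add: abs_less_iff)
    then have "rescaled_translate a v (1/2) h x < \<kappa> * (m + e)"
      using \<kappa> by (simp add: rescaled_translate_def \<kappa>_def)
    also have "\<dots> < m - e"
    proof -
      have "(1 + \<kappa>) * e < 2 * e" using \<kappa> e by simp
      moreover have "2 * e = m - \<kappa> * m" unfolding e_def by (simp add: right_diff_distrib)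
      ultimately show ?thesis by (simp add: algebra_simps)
    qed
    also have "\<dots> < v x"
    proof -
      have "norm x < r2" using that r by linarith
      then show ?thesis using r2(2)[of x] by (simp add: abs_less_iff)
    qed
    also have "\<dots> < u x" using uv that r by auto
    finally show ?thesis .
  qed
  define L where "L h = (m / v h) powr (1/a)" for h
  have L0: "L 0 = 1" using m by (simp add: L_def m_def)
  have Lc: "continuous_on (ball 0 2) L"
    unfolding L_def using v(2) m by (intro continuous_intros vc) (auto simp: less_imp_neq[symmetric])
  then have "isCont L 0" using continuous_on_eq_continuous_at[OF open_ball] by (metis centre_in_ball zero_less_numeral)
  then obtain r3 where r3: "r3 > 0" "\<And>h. norm h < r3 \<Longrightarrow> \<bar>L h - 1\<bar> < 1/2"
    using isCont_0_near[of L "1/2"] L0 by auto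
  have Lb: "1/2 < L h" "L h \<le> 2" if "norm h < r3" for h
    using r3(2)[OF that] abs_ge_self[of "L h - 1"] abs_ge_minus_self[of "L h - 1"] by linarith+
  define r4 where "r4 = min (r3 / 2) r"
  have r4: "0 < r4" "r4 < r3" "r4 \<le> r" using r r3 by (auto simp: r4_def)
  define \<Phi> where "\<Phi> z = u (snd z) - rescaled_translate a v (L (fst z)) (fst z) (snd z)" for z
  have opu: "open (ball (0::real^'n) 2 - {0})" by auto
  have uc: "continuous_on (ball 0 2 - {0}) u" using C2_on_continuous(1)[OF u opu] .
  have inB: "L h *\<^sub>R x + h \<in> ball 0 2" if "norm x \<le> r" "norm h \<le> r4" for x h
  proof -
    have "norm (L h *\<^sub>R x + h) \<le> L h * norm x + norm h"
      using norm_triangle_ineq[of "L h *\<^sub>R x" h] Lb[of h] that r4 by simp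
    also have "\<dots> \<le> 2 * r + r" using that r r4 Lb[of h] by (intro add_mono mult_mono) auto
    finally show ?thesis using r by simp
  qed
  have "continuous_on (cball 0 r4 \<times> sphere 0 r) \<Phi>"
    unfolding \<Phi>_def rescaled_translate_def
  proof (intro continuous_intros continuous_on_compose2[OF uc] continuous_on_compose2[OF vc]
        continuous_on_compose2[OF Lc])
    show "\<forall>z\<in>cball 0 r4 \<times> sphere (0::real^'n) r. L (fst z) \<noteq> 0"
    proof
      fix z :: "(real^'n) \<times> (real^'n)" assume "z \<in> cball 0 r4 \<times> sphere 0 r"
      then have "norm (fst z) < r3" using r4 by auto
      from Lb(1)[OF this] show "L (fst z) \<noteq> 0" by auto
    qed
    show "snd ` (cball 0 r4 \<times> sphere 0 r) \<subseteq> ball 0 2 - {0::real^'n}" using r by auto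
    show "fst ` (cball (0::real^'n) r4 \<times> sphere 0 r) \<subseteq> ball 0 2"
         "fst ` (cball (0::real^'n) r4 \<times> sphere 0 r) \<subseteq> ball 0 2" using r r4 by auto
    show "(\<lambda>z. L (fst z) *\<^sub>R snd z + fst z) ` (cball 0 r4 \<times> sphere 0 r) \<subseteq> ball 0 2"
      using inB by force
  qed
  then have unif: "uniformly_continuous_on (cball 0 r4 \<times> sphere 0 r) \<Phi>"
    by (intro compact_uniformly_continuous compact_Times) auto
  have "continuous_on (sphere 0 r) (\<lambda>x. u x - v x)"
    using r by (intro continuous_intros continuous_on_subset[OF uc] continuous_on_subset[OF vc]) auto
  then obtain x1 where x1: "x1 \<in> sphere 0 r" "\<And>x. x \<in> sphere 0 r \<Longrightarrow> u x1 - v x1 \<le> u x - v x"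
    using continuous_attains_inf[of "sphere (0::real^'n) r" "\<lambda>x. u x - v x"] r by auto
  define \<mu> where "\<mu> = u x1 - v x1"
  have \<mu>: "\<mu> > 0" using uv x1 r by (auto simp: \<mu>_def)
  obtain d where d: "d > 0" "\<And>z z'. z \<in> cball 0 r4 \<times> sphere 0 r \<Longrightarrow> z' \<in> cball 0 r4 \<times> sphere 0 r \<Longrightarrow>
      dist z' z < d \<Longrightarrow> dist (\<Phi> z') (\<Phi> z) < \<mu>"
    using unif \<mu> unfolding uniformly_continuous_on_def by metis
  define k where "k = min d r4"
  have k: "0 < k" "k \<le> d" "k \<le> r4" using d r4 by (auto simp: k_def)
  show ?thesis
  proof (rule that[of r k])
    fix x h :: "real^'n" assume x: "x \<noteq> 0" "norm x \<le> r" and h: "norm h < k"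
    have hr: "norm h \<le> r" "norm h < r3" using h k r4 by auto
    have vh: "v h > 0" using v(2) hr r by auto
    show "rescaled_translate a v ((v 0 / v h) powr (1/a)) h x \<le> u x"
      unfolding m_def[symmetric] L_def[symmetric]
    proof (rule rescaled_translate_below[OF n C1 ell inv a u v uv Tuv r(1) r(4) hr(1) Lb(1)[OF hr(2)] Lb(2)[OF hr(2)] _ _ _ _ x])
      show "rescaled_translate a v l h x \<le> rescaled_translate a v l' h x"
        if "norm x \<le> r" "1/2 \<le> l" "l \<le> l'" "l' \<le> 2" for x l l'
        using r1(2) that r hr by auto
      show "rescaled_translate a v (1/2) h x < u x" if "x \<noteq> 0" "norm x \<le> r" for x
        by (rule start[OF that hr(1)])
      show "rescaled_translate a v (L h) h x < u x" if "norm x = r" for x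
      proof -
        have "dist (\<Phi> (h, x)) (\<Phi> (0, x)) < \<mu>"
          using that h k r4 by (intro d(2)) (auto simp: dist_Pair_Pair)
        moreover have "\<Phi> (0, x) \<ge> \<mu>"
          using x1(2)[of x] that L0 by (simp add: \<Phi>_def \<mu>_def rescaled_translate_def)
        ultimately have "\<Phi> (h, x) > 0" by (simp add: dist_real_def abs_less_iff)
        then show ?thesis by (simp add: \<Phi>_def)
      qed
      have "L h powr a = m / v h" using a0 m vh by (simp add: L_def powr_powr)
      then show "L h powr a * v h \<le> v 0" using vh by (simp add: m_def)
    qed
  qed (use r k r4 in auto)
qed

section \<open>Rigidity when all translates touch, and the conclusion\<close>

text \<open>The gradient condition says that a power of \<open>v\<close> is affine. Differentiating it once more exhibits
  the Hessian as a nonnegative multiple of \<open>b b\<^sup>T\<close>.\<close>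

lemma laplacian_nonneg_if_grad_powr:
  fixes v :: "real^'n \<Rightarrow> real"
  assumes v: "C2_on S v" "open S" and pos: "\<And>y. y \<in> S \<Longrightarrow> v y > 0" and m: "m > 0" and c: "c \<ge> 0"
    and g: "\<And>y. y \<in> S \<Longrightarrow> grad v y = ((v y / m) powr c) *\<^sub>R b" and x: "x \<in> S"
  shows "laplacian v x \<ge> 0"
proof -
  let ?d = "c * (v x / m) powr (c - 1) * (1 / m)"
  have vx: "v x / m > 0" using pos x m by simp
  have dv: "(v has_derivative (\<lambda>z. grad v x \<bullet> z)) (at x)"
    using has_derivative_grad v x unfolding C2_on_def by blast
  have "((\<lambda>s. (s / m) powr c) has_real_derivative ?d) (at (v x))"
    using vx by (auto intro!: derivative_eq_intros)
  then have "((\<lambda>y. (v y / m) powr c) has_derivative (\<lambda>z. ?d * (grad v x \<bullet> z))) (at x)"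
    using has_derivative_compose[OF dv] unfolding has_field_derivative_def by fast
  from has_derivative_scaleR_left[OF this, of b]
  have "((\<lambda>y. ((v y / m) powr c) *\<^sub>R b) has_derivative (\<lambda>z. (?d * (grad v x \<bullet> z)) *\<^sub>R b)) (at x)" .
  from has_derivative_transform_within_open[OF this v(2) x, of "grad v"] g
  have D: "(grad v has_derivative (\<lambda>z. (?d * (grad v x \<bullet> z)) *\<^sub>R b)) (at x)" by simp
  have lin: "linear (\<lambda>z. (?d * (grad v x \<bullet> z)) *\<^sub>R b)"
    using has_derivative_bounded_linear[OF D] bounded_linear.linear by blast
  have "hess v x *v z = (?d * (grad v x \<bullet> z)) *\<^sub>R b" for z
    unfolding hess_def frechet_derivative_at[OF D, symmetric]
    using lin by (simp add: matrix_works)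
  then have "hess v x $ i $ i = ?d * (grad v x $ i * b $ i)" for i
    using matrix_vector_mul_component[of "hess v x" "axis i 1" i] by (simp add: inner_axis)
  then have "laplacian v x = ?d * (grad v x \<bullet> b)"
    by (simp add: laplacian_def trace_def inner_vec_def sum_distrib_left)
  also have "\<dots> = ?d * ((v x / m) powr c) * (b \<bullet> b)" by (simp add: g[OF x])
  finally show ?thesis using c m by simp
qed

lemma gap_if_subharmonic:
  fixes u v :: "real^'n \<Rightarrow> real"
  assumes n: "CARD('n) \<ge> 3" and R: "0 < R"
    and u: "C2_on (ball 0 R - {0}) u" and v: "C2_on (ball 0 R) v"
    and uv: "\<And>x. x \<in> ball 0 R - {0} \<Longrightarrow> v x < u x"
    and lu: "\<And>x. x \<in> ball 0 R - {0} \<Longrightarrow> laplacian u x \<le> 0"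
    and lv: "\<And>x. x \<in> ball 0 R - {0} \<Longrightarrow> laplacian v x \<ge> 0"
  obtains \<delta> where "\<delta> > 0" "\<And>x. x \<noteq> 0 \<Longrightarrow> norm x < R / 2 \<Longrightarrow> \<delta> \<le> u x - v x"
proof -
  define r where "r = R / 2"
  have r: "0 < r" "r < R" using R by (auto simp: r_def)
  have op: "open (ball (0::real^'n) R - {0})" by auto
  have uc: "continuous_on (cball 0 r - {0}) u" and vc: "continuous_on (cball 0 r) v"
    using r by (intro continuous_on_subset[OF C2_on_continuous(1)[OF u op]]
        continuous_on_subset[OF C2_on_continuous(1)[OF v open_ball]]; force)+
  have "continuous_on (sphere 0 r) (\<lambda>x. u x - v x)"
    using r by (intro continuous_intros continuous_on_subset[OF uc] continuous_on_subset[OF vc]) auto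
  then obtain x1 where x1: "x1 \<in> sphere 0 r" "\<And>x. x \<in> sphere 0 r \<Longrightarrow> u x1 - v x1 \<le> u x - v x"
    using continuous_attains_inf[of "sphere (0::real^'n) r" "\<lambda>x. u x - v x"] r by auto
  define \<delta> where "\<delta> = u x1 - v x1"
  have \<delta>: "\<delta> > 0" using uv[of x1] x1 r by (auto simp: \<delta>_def)
  obtain b where b: "\<And>x. x \<in> cball 0 r \<Longrightarrow> b \<le> v x"
    using continuous_attains_inf[OF compact_cball _ vc] r by force
  have "\<delta> \<le> u x - v x" if x: "x \<noteq> 0" "norm x < r" for x
  proof -
    have "v x + \<delta> \<le> u x"
    proof (rule punctured_minimum_principle[OF n r(1) uc, where b=b])
      show "continuous_on (cball 0 r) (\<lambda>x. v x + \<delta>)" by (intro continuous_intros vc)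
      show "\<exists>p M. has_2jet u x p M \<and> trace M \<le> 0" if "x \<in> ball 0 r - {0}" for x
        using C2_on_has_2jet[OF u op, of x] lu[of x] that r unfolding laplacian_def by auto
      show "\<exists>p M. has_2jet (\<lambda>x. v x + \<delta>) x p M \<and> 0 \<le> trace M" if "x \<in> ball 0 r - {0}" for x
      proof -
        have "has_2jet (\<lambda>x. \<delta>) x 0 (0 :: real^'n^'n)"
          using has_2jet_quadratic[of "0 :: real^'n^'n" \<delta> 0 0 x] by (simp add: transpose_def vec_eq_iff)
        from has_2jet_add[OF C2_on_has_2jet[OF v open_ball, of x] this] lv[of x] that r
        show ?thesis unfolding laplacian_def by auto
      qed
      show "b \<le> u x" if "x \<in> ball 0 r - {0}" for x
        using b[of x] uv[of x] that r by force
      show "v x + \<delta> \<le> u x" if "x \<in> sphere 0 r" for x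
        using x1(2)[OF that] by (simp add: \<delta>_def)
    qed (use x in auto)
    then show ?thesis by simp
  qed
  then show ?thesis using that[OF \<delta>] by (simp add: r_def)
qed

lemma Liminf_pos_if_gap:
  fixes f :: "'a::real_normed_vector \<Rightarrow> real"
  assumes "\<delta> > 0" "d > 0" "\<And>x. x \<noteq> 0 \<Longrightarrow> norm x < d \<Longrightarrow> \<delta> \<le> f x"
  shows "Liminf (at 0) (\<lambda>x. ereal (f x)) > 0"
proof -
  have "\<forall>\<^sub>F x in at 0. ereal \<delta> \<le> ereal (f x)"
    unfolding eventually_at using assms by (intro exI[of _ d]) auto
  then have "ereal \<delta> \<le> Liminf (at 0) (\<lambda>x. ereal (f x))" by (rule Liminf_bounded)
  moreover have "0 < ereal \<delta>" using assms by simp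
  ultimately show ?thesis by (rule less_le_trans[rotated])
qed

theorem theorem1p7:
  fixes T :: "real \<times> (real^'n) \<times> (real^'n^'n) \<Rightarrow> real"
    and u v :: "real^'n \<Rightarrow> real"
  assumes "CARD('n) \<ge> 3"
    and "C1_on jet_domain T"
    and "elliptic T"
    and "scaling_invariant T"
    and "C2_on (ball 0 2 - {0}) u"
    and "C2_on (ball 0 2) v"
    and "\<forall>x \<in> ball 0 2. v x > 0"
    and "\<forall>x \<in> ball 0 2 - {0}. u x > v x"
    and "\<forall>x \<in> ball 0 2 - {0}. laplacian u x \<le> 0"
    and "\<forall>x \<in> ball 0 2 - {0}. T (jet u x) \<ge> 0 \<and> 0 \<ge> T (jet v x)"
  shows "Liminf (at 0) (\<lambda>x. ereal (u x - v x)) > 0"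
proof -
  define a where "a = (real CARD('n) - 2) / 2"
  have a0: "a > 0" using assms(1) by (simp add: a_def)
  define m where "m = v 0"
  have m: "m > 0" using assms(7) by (simp add: m_def)
  obtain r k where r: "0 < r" "r \<le> 1/2" and k: "0 < k" "k \<le> 2"
    and below: "\<And>x h. x \<noteq> 0 \<Longrightarrow> norm x \<le> r \<Longrightarrow> norm h < k \<Longrightarrow>
        rescaled_translate a v ((m / v h) powr (1/a)) h x \<le> u x"
    using matched_translates_below[OF assms(1-4) a_def assms(5-8,10)] unfolding m_def by metis
  define L where "L h = (m / v h) powr (1/a)" for h
  have pos: "v h > 0" if "norm h < k" for h using assms(7) that k by auto
  have L: "L h > 0" "L h powr a = m / v h" if "norm h < k" for h
    using pos[OF that] m a0 by (auto simp: L_def powr_powr)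
  \<comment> \<open>The gradient at the origin of the translate by \<open>h\<close> that has the value \<open>m\<close> there.\<close>
  define G where "G h = (L h powr a * L h) *\<^sub>R grad v h" for h
  have sub: "ball (0::real^'n) r - {0} \<subseteq> ball 0 2 - {0}" using r by auto
  have u: "C2_on (ball 0 r - {0}) u"
    using assms(5) sub unfolding C2_on_def by (auto intro: continuous_on_subset)
  show ?thesis
  proof (cases "\<forall>h. norm h < k \<longrightarrow> G h = grad v 0")
    \<comment> \<open>Two functions below \<open>u\<close> with the same value and different gradients at the puncture.\<close>
    case False
    then obtain h where h: "norm h < k" "grad v 0 \<noteq> G h" by metis
    have hB: "L h *\<^sub>R 0 + h \<in> ball 0 2" using h k by simp
    have "(v has_derivative (\<lambda>z. grad v 0 \<bullet> z)) (at 0)"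
      using has_derivative_grad assms(6) unfolding C2_on_def by (metis centre_in_ball zero_less_numeral)
    moreover have "(rescaled_translate a v (L h) h has_derivative (\<lambda>z. G h \<bullet> z)) (at 0)"
    proof -
      note j = has_2jet_rescaled_translate[OF assms(6) open_ball hB, of a]
      have "grad (rescaled_translate a v (L h) h) 0 = G h"
        using has_2jetD(1)[OF j] by (simp add: G_def)
      then show ?thesis using has_derivative_grad[OF has_2jet_differentiable(1)[OF j]] by simp
    qed
    moreover have "rescaled_translate a v (L h) h 0 = m"
      using L(2)[OF h(1)] pos[OF h(1)] by (simp add: rescaled_translate_def)
    ultimately obtain c \<rho> where c: "c > m" "\<rho> > 0" "\<And>x. x \<in> ball 0 \<rho> - {0} \<Longrightarrow> c \<le> u x"
      using corner_lower_bound[OF assms(1) r(1) u, of v "grad v 0" m "rescaled_translate a v (L h) h" "G h"]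
        assms(8,9) sub below[OF _ _ h(1)] h(2)
      by (auto simp: m_def subset_iff L_def less_imp_le)
    have "isCont v 0"
      using C2_on_continuous(1)[OF assms(6) open_ball] continuous_on_eq_continuous_at[OF open_ball]
      by (metis centre_in_ball zero_less_numeral)
    then obtain d where d: "d > 0" "\<And>x. norm x < d \<Longrightarrow> \<bar>v x - m\<bar> < (c - m) / 2"
      using isCont_0_near[of v "(c - m) / 2"] c(1) by (auto simp: m_def)
    show ?thesis
    proof (rule Liminf_pos_if_gap[of "(c - m) / 2" "min d \<rho>"])
      show "(c - m) / 2 \<le> u x - v x" if "x \<noteq> 0" "norm x < min d \<rho>" for x
        using c(3)[of x] d(2)[of x] that abs_ge_self[of "v x - m"] by (simp add: field_simps)
    qed (use c d in auto)
  next
    case True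
    \<comment> \<open>Equality of all these gradients is a first order equation for \<open>v\<close> near the origin.\<close>
    have grad: "grad v h = ((v h / m) powr (1 + 1/a)) *\<^sub>R grad v 0" if "h \<in> ball 0 k" for h
    proof -
      have hk: "norm h < k" using that by simp
      have q: "v h / m > 0" using pos[OF hk] m by simp
      have e1: "L h = (v h / m) powr (- (1/a))"
      proof -
        have "m / v h = inverse (v h / m)" by simp
        then show ?thesis by (simp only: L_def powr_minus inverse_powr)
      qed
      have e2: "m / v h = (v h / m) powr (- 1)"
        using pos[OF hk] m by (simp add: powr_minus)
      have "(v h / m) powr (1 + 1/a) * (L h powr a * L h) = 1"
        unfolding L(2)[OF hk] unfolding e1 e2 powr_add[symmetric] using pos[OF hk] m by simp
      then have "((v h / m) powr (1 + 1/a)) *\<^sub>R G h = grad v h"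
        unfolding G_def scaleR_scaleR by (simp only: scaleR_one)
      moreover have "G h = grad v 0" using True hk by blast
      ultimately show ?thesis by simp
    qed
    have lap: "laplacian v x \<ge> 0" if "x \<in> ball 0 k" for x
    proof (rule laplacian_nonneg_if_grad_powr[OF _ open_ball _ m _ grad that])
      show "C2_on (ball 0 k) v"
        using assms(6) k unfolding C2_on_def by (auto intro: continuous_on_subset)
    qed (use pos a0 in auto)
    define R where "R = min r k"
    have R: "0 < R" "R \<le> r" "R \<le> k" using r k by (auto simp: R_def)
    obtain \<delta> where \<delta>: "\<delta> > 0" "\<And>x. x \<noteq> 0 \<Longrightarrow> norm x < R / 2 \<Longrightarrow> \<delta> \<le> u x - v x"
    proof (rule gap_if_subharmonic[OF assms(1) R(1)])
      show "C2_on (ball 0 R - {0}) u" "C2_on (ball 0 R) v"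
        using assms(5,6) R r unfolding C2_on_def by (auto intro: continuous_on_subset)
    qed (use assms(8,9) R r lap in auto)
    show ?thesis by (rule Liminf_pos_if_gap[where d="R / 2", OF \<delta>(1) _ \<delta>(2)]) (use R in auto)
  qed
qed

end
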